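(* Let $\mathcal{H}_A,\mathcal{H}_B,\mathcal{H}_C$ be finite-dimensional Hilbert spaces. For any strictly positive definite density matrix $\rho_{AB}$ on $\mathcal{H}_A\otimes\mathcal{H}_B$, any strictly positive definite density matrix $\sigma_{BC}$ on $\mathcal{H}_B\otimes\mathcal{H}_C$, and any $\alpha\in[0,1]$, $$\rho_A^{-\alpha}\otimes \sigma_{BC}^{\alpha} \;\leq\; \rho_{AB}^{-\alpha}\otimes \sigma_C^{\alpha}$$ as operators on $\mathcal{H}_A\otimes\mathcal{H}_B\otimes\mathcal{H}_C$.
   Context: A density matrix is a positive semidefinite operator of trace one. Marginals are partial traces: $\rho_A=\mathrm{Tr}_B\,\rho_{AB}$, $\sigma_C=\mathrm{Tr}_B\,\sigma_{BC}$. The tensor factors are ordered as $\mathcal{H}_A\otimes\mathcal{H}_B\otimes\mathcal{H}_C$. Powers of positive definite operators are defined by functional calculus. For Hermitian operators, $X\leq Y$ means $Y-X$ is positive semidefinite. *)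

theory Defs
  imports Complex_Main "Jordan_Normal_Form.Matrix"
begin

text \<open>Operators on a d-dimensional Hilbert space are complex d x d matrices
  (with respect to a fixed orthonormal basis).\<close>

definition adjoint :: "complex mat \<Rightarrow> complex mat" where
  "adjoint A = mat (dim_col A) (dim_row A) (\<lambda>(i,j). cnj (A $$ (j,i)))"

definition hermitian :: "complex mat \<Rightarrow> bool" where
  "hermitian A \<longleftrightarrow> dim_row A = dim_col A \<and> adjoint A = A"

definition qform :: "complex mat \<Rightarrow> complex vec \<Rightarrow> complex" where
  "qform A v = (\<Sum>i<dim_vec v. cnj (v $ i) * (A *\<^sub>v v) $ i)"

definition psd :: "complex mat \<Rightarrow> bool" where
  "psd A \<longleftrightarrow> hermitian A \<and>
     (\<forall>v \<in> carrier_vec (dim_row A). Im (qform A v) = 0 \<and> Re (qform A v) \<ge> 0)"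

definition pos_def :: "complex mat \<Rightarrow> bool" where
  "pos_def A \<longleftrightarrow> hermitian A \<and>
     (\<forall>v \<in> carrier_vec (dim_row A). v \<noteq> 0\<^sub>v (dim_row A) \<longrightarrow>
        Im (qform A v) = 0 \<and> Re (qform A v) > 0)"

definition mtrace :: "complex mat \<Rightarrow> complex" where
  "mtrace A = (\<Sum>i<dim_row A. A $$ (i,i))"

definition density :: "complex mat \<Rightarrow> bool" where
  "density A \<longleftrightarrow> psd A \<and> mtrace A = 1"

definition loewner_le :: "complex mat \<Rightarrow> complex mat \<Rightarrow> bool" where
  "loewner_le X Y \<longleftrightarrow> dim_row X = dim_row Y \<and> dim_col X = dim_col Y \<and> psd (Y - X)"

definition kron :: "complex mat \<Rightarrow> complex mat \<Rightarrow> complex mat" where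
  "kron A B = mat (dim_row A * dim_row B) (dim_col A * dim_col B)
     (\<lambda>(i,j). A $$ (i div dim_row B, j div dim_col B) * B $$ (i mod dim_row B, j mod dim_col B))"

definition ptrace2 :: "nat \<Rightarrow> nat \<Rightarrow> complex mat \<Rightarrow> complex mat" where
  "ptrace2 d1 d2 R = mat d1 d1 (\<lambda>(i,j). \<Sum>k<d2. R $$ (i * d2 + k, j * d2 + k))"

definition ptrace1 :: "nat \<Rightarrow> nat \<Rightarrow> complex mat \<Rightarrow> complex mat" where
  "ptrace1 d1 d2 R = mat d2 d2 (\<lambda>(i,j). \<Sum>k<d1. R $$ (k * d2 + i, k * d2 + j))"

definition unitary :: "nat \<Rightarrow> complex mat \<Rightarrow> bool" where
  "unitary n U \<longleftrightarrow> U \<in> carrier_mat n n \<and> adjoint U * U = 1\<^sub>m n \<and> U * adjoint U = 1\<^sub>m n"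

definition diag_of :: "nat \<Rightarrow> (nat \<Rightarrow> complex) \<Rightarrow> complex mat" where
  "diag_of n d = mat n n (\<lambda>(i,j). if i = j then d i else 0)"

text \<open>Real power of a positive definite matrix via functional calculus:
  if A = U diag(d) U^* with U unitary and d > 0, then A^t = U diag(d^t) U^*.
  (Independent of the chosen diagonalisation; meaningful for positive definite A.)\<close>
definition mpow :: "complex mat \<Rightarrow> real \<Rightarrow> complex mat" where
  "mpow A t = (let n = dim_row A;
      (U, d) = (SOME (U, d). unitary n U \<and> (\<forall>i<n. d i > (0::real)) \<and>
                   A = U * diag_of n (\<lambda>i. complex_of_real (d i)) * adjoint U)
    in U * diag_of n (\<lambda>i. complex_of_real (d i powr t)) * adjoint U)"

end

theory Submission
  imports "HOL-Analysis.Analysis" "Jordan_Normal_Form.Spectral_Radius" Defs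
begin

text \<open>The case \<open>\<alpha> = 1\<close> holds because the partial trace is a compression: decomposing \<open>\<sigma>\<close> into rank-one
  operators, it reduces to the statement that \<open>V * (inverse (V\<^sup>* * M * V)) * V\<^sup>* \<le> inverse M\<close>, which is Fenchel's inequality
  \<open>2 Re \<langle>z, u\<rangle> \<le> \<langle>z, inverse M z\<rangle> + \<langle>u, M u\<rangle>\<close> at a suitable \<open>u\<close>. Both sides for general \<open>\<alpha>\<close> are
  the \<open>\<alpha>\<close>-th powers of the sides for \<open>\<alpha> = 1\<close>, so operator monotonicity of \<open>t \<mapsto> t\<^sup>\<alpha>\<close> (Loewner--Heinz) finishes the
  proof. The latter follows from the representation of \<open>a powr \<alpha>\<close> as an integral of \<open>a / (a + t)\<close> over \<open>t > 0\<close>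
  and the monotonicity of resolvents.\<close>

unbundle no vec_syntax
hide_const (open) Linear_Algebra.adjoint Finite_Cartesian_Product.mat
hide_fact (open) Linear_Algebra.adjoint_def

section \<open>Integral representation of powers\<close>

text \<open>Operators are compared only through their real quadratic forms, written as weighted sums
  in eigenbases. The integral is therefore one of scalar functions, and an inverse is the same
  eigenbasis with inverted eigenvalues. For general matrices a product of powers such as
  A^(-\<alpha>) B^\<alpha> is not the power of anything convenient. Here the two factors on each
  side act on different tensor factors and so commute: the Kronecker product of the two eigenbases
  diagonalises the whole side, its eigenvalues are products, and the exponents -\<alpha> and
  \<alpha> merge into a single power. This is what allows one operator inequality at exponent one to
  carry all exponents in [0,1]. \<open>mpow\<close> picks some unitary diagonalisation, about which
  nothing is known until one is shown to exist; hence the spectral theorem for hermitian matrices is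
  proved along the way.\<close>

lemma powr_integral_representation:
  fixes s :: real
  assumes s: "0 < s" "s < 1"
  obtains C :: ennreal where "C \<noteq> 0" "C \<noteq> \<infinity>"
    "\<And>a. 0 < a \<Longrightarrow> (\<integral>\<^sup>+t. ennreal (indicator {0<..} t * (a / (a + t) * t powr (s - 1))) \<partial>lborel) = ennreal (a powr s) * C"
proof
  define g :: "real \<Rightarrow> real \<Rightarrow> real" where "g a t = indicator {0<..} t * (a / (a + t) * t powr (s - 1))" for a t
  \<comment> \<open>The integral at \<open>a = 1\<close>, whose value is pi / sin (pi s). To cancel
    \<open>C\<close> from an inequality it is enough that it is neither 0 nor infinite. Integrals in
    \<open>ennreal\<close> carry no integrability side conditions.\<close>
  define C where "C = (\<integral>\<^sup>+t. ennreal (g 1 t) \<partial>lborel)"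
  have g [measurable]: "g a \<in> borel_measurable borel" for a unfolding g_def by measurable
  have sub: "((\<lambda>x. x powr (s - 1)) has_integral (1 / s)) {0..1}"
    using has_integral_powr_from_0[of "s - 1" 1] s by simp
  have sup: "((\<lambda>x. x powr (s - 2)) has_integral (1 / (1 - s))) {1..}"
  proof -
    have "- (1 / (s - 1)) = 1 / (1 - s)" by (metis minus_diff_eq minus_divide_right)
    then show ?thesis using has_integral_powr_to_inf[of "s - 2" 1] s by simp
  qed
  have i0: "(\<integral>\<^sup>+t. ennreal (indicator {0..1} t * t powr (s - 1)) \<partial>lborel) = ennreal (1 / s)"
    using nn_integral_has_integral_lebesgue[OF _ sub] by (simp add: nn_integral_completion mult.commute)
  have i1: "(\<integral>\<^sup>+t. ennreal (indicator {1..} t * t powr (s - 2)) \<partial>lborel) = ennreal (1 / (1 - s))"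
    using nn_integral_has_integral_lebesgue[OF _ sup] by (simp add: nn_integral_completion mult.commute)
  \<comment> \<open>Near 0 the factor 1 / (1 + t) is bounded by 1, near infinity by 1 / t. The first
    bound is integrable because s > 0, the second because s < 1.\<close>
  have up: "g 1 t \<le> indicator {0..1} t * t powr (s - 1) + indicator {1..} t * t powr (s - 2)" for t
  proof (cases "t > 0")
    case True
    have "1 / (1 + t) * t powr (s - 1) \<le> t powr (s - 1)"
      using True by (intro mult_left_le_one_le) auto
    moreover have "1 / (1 + t) * t powr (s - 1) \<le> t powr (s - 2)"
    proof -
      have "t powr (s - 2) = t powr (s - 1) / t" using True powr_diff[of t "s - 1" 1] by simp
      then show ?thesis using True by (simp add: field_simps)
    qed
    ultimately show ?thesis using True by (auto simp: g_def indicator_def)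
  qed (auto simp: g_def indicator_def)
  have "C \<le> (\<integral>\<^sup>+t. ennreal (indicator {0..1} t * t powr (s - 1)) + ennreal (indicator {1..} t * t powr (s - 2)) \<partial>lborel)"
    unfolding C_def by (intro nn_integral_mono) (use up in \<open>simp flip: ennreal_plus\<close>)
  also have "\<dots> = ennreal (1 / s) + ennreal (1 / (1 - s))"
    by (subst nn_integral_add) (simp_all add: i0 i1)
  also have "\<dots> < \<infinity>" by simp
  finally show "C \<noteq> \<infinity>" by simp
  \<comment> \<open>On (0, 1] both 1 / (1 + t) >= 1/2 and t^(s-1) >= 1 hold, so the integral is at
    least 1/2.\<close>
  have "ennreal (1 / 2) = (\<integral>\<^sup>+t. ennreal (1/2) * indicator {0<..1::real} t \<partial>lborel)"
    by (subst nn_integral_cmult_indicator) auto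
  also have "\<dots> \<le> C" unfolding C_def
  proof (intro nn_integral_mono)
    fix t :: real
    have "1 / 2 \<le> g 1 t" if t: "0 < t" "t \<le> 1"
    proof -
      have "1 powr (s - 1) \<le> t powr (s - 1)" using t s by (intro powr_mono2') auto
      then have "1 / 2 * 1 \<le> 1 / (1 + t) * t powr (s - 1)"
        using t by (intro mult_mono) (auto simp: field_simps)
      then show ?thesis using t by (simp add: g_def)
    qed
    then show "ennreal (1/2) * indicator {0<..1::real} t \<le> ennreal (g 1 t)"
      by (cases "0 < t \<and> t \<le> 1") (simp_all add: ennreal_leI del: ennreal_half)
  qed
  finally show "C \<noteq> 0" by (auto simp del: ennreal_half)
  fix a :: real assume a: "0 < a"
  \<comment> \<open>Homogeneity of the integrand under t -> a t; the leading \<open>a\<close> on the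
    left is the Jacobian of this substitution.\<close>
  have sc: "a * g a (a * t) = a powr s * g 1 t" for t
  proof (cases "t > 0")
    case True
    have "a * (a / (a + a * t)) = a * (1 / (1 + t))"
      using a True nonzero_mult_divide_mult_cancel_left[of a 1 "1 + t"] by (simp add: algebra_simps)
    moreover have "a * a powr (s - 1) = a powr s" using a powr_add[of a 1 "s - 1"] by simp
    ultimately have "a * (a / (a + a * t)) * (a powr (s - 1) * t powr (s - 1)) = a powr s * (1 / (1 + t) * t powr (s - 1))"
      by (metis mult.assoc mult.commute)
    then show ?thesis using a True by (simp add: g_def powr_mult del: times_divide_eq_right) (simp add: mult.assoc)
  qed (use a in \<open>auto simp: g_def zero_less_mult_iff\<close>)
  have "(\<integral>\<^sup>+t. ennreal (g a t) \<partial>lborel) = ennreal a * (\<integral>\<^sup>+t. ennreal (g a (a * t)) \<partial>lborel)"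
    using nn_integral_real_affine[of "\<lambda>t. ennreal (g a t)" a 0] a by simp
  also have "\<dots> = (\<integral>\<^sup>+t. ennreal (a powr s) * ennreal (g 1 t) \<partial>lborel)"
    using a by (subst nn_integral_cmult[symmetric]) (auto simp: sc simp flip: ennreal_mult')
  also have "\<dots> = ennreal (a powr s) * C" unfolding C_def by (rule nn_integral_cmult) auto
  finally show "(\<integral>\<^sup>+t. ennreal (indicator {0<..} t * (a / (a + t) * t powr (s - 1))) \<partial>lborel) = ennreal (a powr s) * C"
    by (simp add: g_def)
qed

text \<open>Integrating the hypothesis against t^(s-1) over t > 0 yields the conclusion multiplied
  by the constant \<open>C\<close>, which cancels. In the application \<open>a\<close> and
  \<open>b\<close> are the eigenvalues of two operators, and \<open>p\<close> and \<open>q\<close>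
  the squared moduli of the coordinates of one vector in the two eigenbases.\<close>

lemma sum_powr_le_of_resolvents:
  fixes p a q b :: "nat \<Rightarrow> real" and s :: real
  assumes s: "0 < s" "s < 1"
    and p: "\<And>i. i < m \<Longrightarrow> 0 \<le> p i" "\<And>i. i < m \<Longrightarrow> 0 < a i"
    and q: "\<And>i. i < n \<Longrightarrow> 0 \<le> q i" "\<And>i. i < n \<Longrightarrow> 0 < b i"
    and le: "\<And>t. 0 < t \<Longrightarrow> (\<Sum>i<m. p i * (a i / (a i + t))) \<le> (\<Sum>i<n. q i * (b i / (b i + t)))"
  shows "(\<Sum>i<m. p i * a i powr s) \<le> (\<Sum>i<n. q i * b i powr s)"
proof -
  obtain C :: ennreal where C: "C \<noteq> 0" "C \<noteq> \<infinity>"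
    and int: "\<And>a. 0 < a \<Longrightarrow> (\<integral>\<^sup>+t. ennreal (indicator {0<..} t * (a / (a + t) * t powr (s - 1))) \<partial>lborel) = ennreal (a powr s) * C"
    by (rule powr_integral_representation[OF s]) blast
  have eq: "ennreal (\<Sum>i<m. p i * a i powr s) * C =
      (\<integral>\<^sup>+t. ennreal (indicator {0<..} t * ((\<Sum>i<m. p i * (a i / (a i + t))) * t powr (s - 1))) \<partial>lborel)"
    if p: "\<And>i. i < m \<Longrightarrow> 0 \<le> p i" "\<And>i. i < m \<Longrightarrow> 0 < a i" for m and p a :: "nat \<Rightarrow> real"
  proof -
    have "ennreal (\<Sum>i<m. p i * a i powr s) = (\<Sum>i<m. ennreal (p i * a i powr s))"
      using p by (intro sum_ennreal[symmetric]) auto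
    then have "ennreal (\<Sum>i<m. p i * a i powr s) * C = (\<Sum>i<m. ennreal (p i) * (ennreal (a i powr s) * C))"
      using p by (auto simp: sum_distrib_right ennreal_mult mult.assoc intro!: sum.cong)
    also have "\<dots> = (\<Sum>i<m. \<integral>\<^sup>+t. ennreal (p i) * ennreal (indicator {0<..} t * (a i / (a i + t) * t powr (s - 1))) \<partial>lborel)"
    proof (intro sum.cong refl)
      fix i assume "i \<in> {..<m}"
      then have "0 < a i" using p by simp
      show "ennreal (p i) * (ennreal (a i powr s) * C)
          = (\<integral>\<^sup>+t. ennreal (p i) * ennreal (indicator {0<..} t * (a i / (a i + t) * t powr (s - 1))) \<partial>lborel)"
        unfolding int[OF \<open>0 < a i\<close>, symmetric] by (rule nn_integral_cmult[symmetric]) simp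
    qed
    also have "\<dots> = (\<integral>\<^sup>+t. (\<Sum>i<m. ennreal (p i) * ennreal (indicator {0<..} t * (a i / (a i + t) * t powr (s - 1)))) \<partial>lborel)"
      by (rule nn_integral_sum[symmetric]) auto
    also have "\<dots> = (\<integral>\<^sup>+t. ennreal (indicator {0<..} t * ((\<Sum>i<m. p i * (a i / (a i + t))) * t powr (s - 1))) \<partial>lborel)"
    proof (intro nn_integral_cong)
      fix t :: real
      have nn: "0 \<le> indicator {0<..} t * (a i / (a i + t) * t powr (s - 1))" if "i < m" for i
        using p(2)[OF that] by (auto simp: indicator_def)
      have "(\<Sum>i<m. ennreal (p i) * ennreal (indicator {0<..} t * (a i / (a i + t) * t powr (s - 1))))
          = (\<Sum>i<m. ennreal (p i * (indicator {0<..} t * (a i / (a i + t) * t powr (s - 1)))))"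
        by (intro sum.cong refl ennreal_mult[symmetric] p(1) nn) auto
      also have "\<dots> = ennreal (\<Sum>i<m. p i * (indicator {0<..} t * (a i / (a i + t) * t powr (s - 1))))"
        by (intro sum_ennreal mult_nonneg_nonneg p(1) nn) auto
      also have "(\<Sum>i<m. p i * (indicator {0<..} t * (a i / (a i + t) * t powr (s - 1)))) = 
          indicator {0<..} t * ((\<Sum>i<m. p i * (a i / (a i + t))) * t powr (s - 1))"
        unfolding sum_distrib_left sum_distrib_right by (intro sum.cong) auto
      finally show "(\<Sum>i<m. ennreal (p i) * ennreal (indicator {0<..} t * (a i / (a i + t) * t powr (s - 1))))
        = ennreal (indicator {0<..} t * ((\<Sum>i<m. p i * (a i / (a i + t))) * t powr (s - 1)))" .
    qed
    finally show ?thesis .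
  qed
  have "ennreal (\<Sum>i<m. p i * a i powr s) * C \<le> ennreal (\<Sum>i<n. q i * b i powr s) * C"
  proof -
    have "ennreal (\<Sum>i<m. p i * a i powr s) * C =
      (\<integral>\<^sup>+t. ennreal (indicator {0<..} t * ((\<Sum>i<m. p i * (a i / (a i + t))) * t powr (s - 1))) \<partial>lborel)"
      by (rule eq) (use p in auto)
    also have "\<dots> \<le> (\<integral>\<^sup>+t. ennreal (indicator {0<..} t * ((\<Sum>i<n. q i * (b i / (b i + t))) * t powr (s - 1))) \<partial>lborel)"
      by (intro nn_integral_mono ennreal_leI)
         (auto simp: indicator_def simp del: times_divide_eq_right intro!: mult_right_mono le)
    also have "\<dots> = ennreal (\<Sum>i<n. q i * b i powr s) * C"
      by (rule eq[symmetric]) (use q in auto)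
    finally show ?thesis .
  qed
  then have "ennreal (\<Sum>i<m. p i * a i powr s) \<le> ennreal (\<Sum>i<n. q i * b i powr s)"
    using C by (simp add: ennreal_mult_le_mult_iff mult.commute[of _ C])
  moreover have "0 \<le> (\<Sum>i<n. q i * b i powr s)" using q by (intro sum_nonneg) auto
  ultimately show ?thesis by simp
qed

section \<open>The spectral theorem\<close>

lemma sum_if_eq_left: "finite S \<Longrightarrow> (\<Sum>k\<in>S. (if k = i then f k else 0) * g k) = (if i \<in> S then f i * g i else (0::complex))"
  by (simp add: if_distrib[of "\<lambda>x. x * _"] cong: if_cong)

lemma mult_mat_index:
  assumes "A \<in> carrier_mat n m" "B \<in> carrier_mat m p" "i < n" "j < p"
  shows "(A * B) $$ (i,j) = (\<Sum>k<m. A $$ (i,k) * B $$ (k,j))"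
  using assms by (auto simp: scalar_prod_def lessThan_atLeast0)

lemma mult_mat_vec_index:
  assumes "A \<in> carrier_mat n m" "v \<in> carrier_vec m" "i < n"
  shows "(A *\<^sub>v v) $ i = (\<Sum>k<m. A $$ (i,k) * v $ k)"
  using assms by (auto simp: scalar_prod_def lessThan_atLeast0)

lemma adjoint_carrier [simp]: "A \<in> carrier_mat n m \<Longrightarrow> adjoint A \<in> carrier_mat m n"
  by (auto simp: adjoint_def)

lemma dim_adjoint [simp]: "dim_row (adjoint A) = dim_col A" "dim_col (adjoint A) = dim_row A"
  by (simp_all add: adjoint_def)

lemma adjoint_index [simp]:
  "A \<in> carrier_mat n m \<Longrightarrow> i < m \<Longrightarrow> j < n \<Longrightarrow> adjoint A $$ (i,j) = cnj (A $$ (j,i))"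
  by (auto simp: adjoint_def)

lemma adjoint_mult:
  assumes "A \<in> carrier_mat n m" "B \<in> carrier_mat m p"
  shows "adjoint (A * B) = adjoint B * adjoint A"
proof (rule eq_matI)
  have C: "A * B \<in> carrier_mat n p" "adjoint B * adjoint A \<in> carrier_mat p n"
    using assms mult_carrier_mat[OF adjoint_carrier[OF assms(2)] adjoint_carrier[OF assms(1)]] by auto
  show "dim_row (adjoint (A * B)) = dim_row (adjoint B * adjoint A)"
       "dim_col (adjoint (A * B)) = dim_col (adjoint B * adjoint A)"
    using assms C by (auto simp: adjoint_def)
  fix i j assume "i < dim_row (adjoint B * adjoint A)" "j < dim_col (adjoint B * adjoint A)"
  then have "i < p" "j < n" using C by auto
  then show "adjoint (A * B) $$ (i,j) = (adjoint B * adjoint A) $$ (i,j)"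
    using assms
    by (simp add: adjoint_index[OF C(1)] mult_mat_index[OF assms]
        mult_mat_index[OF adjoint_carrier[OF assms(2)] adjoint_carrier[OF assms(1)]]
        adjoint_index[OF assms(1)] adjoint_index[OF assms(2)] mult.commute del: index_mult_mat(1))
qed

lemma hermitian_iff:
  assumes "A \<in> carrier_mat n n"
  shows "hermitian A \<longleftrightarrow> (\<forall>i<n. \<forall>j<n. cnj (A $$ (j,i)) = A $$ (i,j))"
proof
  assume "hermitian A"
  then have "adjoint A = A" by (simp add: hermitian_def)
  then show "\<forall>i<n. \<forall>j<n. cnj (A $$ (j,i)) = A $$ (i,j)"
    using adjoint_index[OF assms] by metis
next
  assume H: "\<forall>i<n. \<forall>j<n. cnj (A $$ (j,i)) = A $$ (i,j)"
  have "adjoint A = A"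
    by (rule eq_matI) (use assms H adjoint_index[OF assms] in \<open>auto simp: adjoint_def\<close>)
  then show "hermitian A" using assms by (auto simp: hermitian_def)
qed

lemma hermitian_minus:
  assumes "A \<in> carrier_mat n n" "B \<in> carrier_mat n n" "hermitian A" "hermitian B"
  shows "hermitian (A - B)"
proof -
  note h = assms(3)[unfolded hermitian_iff[OF assms(1)], rule_format]
    assms(4)[unfolded hermitian_iff[OF assms(2)], rule_format]
  have "cnj ((A - B) $$ (j,i)) = (A - B) $$ (i,j)" if "i < n" "j < n" for i j
    using h(1)[OF that] h(2)[OF that] that assms(1,2) by simp
  then show ?thesis
    unfolding hermitian_iff[OF minus_carrier_mat[OF assms(2), of A]] by blast
qed

text \<open>The shape that \<open>mpow\<close> produces. A matrix and all its powers share
  \<open>U\<close> and differ only in the real function \<open>f\<close>.\<close>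

definition spec_mat :: "nat \<Rightarrow> complex mat \<Rightarrow> (nat \<Rightarrow> real) \<Rightarrow> complex mat" where
  "spec_mat n U f = U * diag_of n (\<lambda>i. complex_of_real (f i)) * adjoint U"

lemma diag_of_carrier [simp]: "diag_of n d \<in> carrier_mat n n"
  by (simp add: diag_of_def)

lemma spec_mat_carrier [simp]: "U \<in> carrier_mat n n \<Longrightarrow> spec_mat n U f \<in> carrier_mat n n"
  unfolding spec_mat_def by (intro mult_carrier_mat[where n=n]) auto

lemma spec_mat_index:
  assumes "U \<in> carrier_mat n n" "i < n" "j < n"
  shows "spec_mat n U f $$ (i,j) = (\<Sum>k<n. f k * U $$ (i,k) * cnj (U $$ (j,k)))"
proof -
  have C: "U * diag_of n (\<lambda>i. complex_of_real (f i)) \<in> carrier_mat n n"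
    using assms by (intro mult_carrier_mat[where n=n]) auto
  have "(U * diag_of n (\<lambda>i. complex_of_real (f i))) $$ (i,k) = U $$ (i,k) * f k" if "k < n" for k
    using assms that by (subst mult_mat_index[where m=n]) (auto simp: diag_of_def if_distrib cong: if_cong)
  then show ?thesis
    unfolding spec_mat_def using assms C
    by (subst mult_mat_index[where m=n and n=n and p=n]) (auto intro!: sum.cong)
qed

lemma hermitian_spec_mat:
  assumes "U \<in> carrier_mat n n"
  shows "hermitian (spec_mat n U f)"
  by (subst hermitian_iff[where n=n]) (auto simp: assms spec_mat_index mult_ac intro!: sum.cong)

lemma unitary_carrier: "unitary n U \<Longrightarrow> U \<in> carrier_mat n n"
  by (simp add: unitary_def)

lemma unitary_rows:
  assumes "unitary n U" "i < n" "j < n"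
  shows "(\<Sum>k<n. U $$ (i,k) * cnj (U $$ (j,k))) = (if i = j then 1 else 0)"
proof -
  have U: "U \<in> carrier_mat n n" using assms by (simp add: unitary_def)
  have "(U * adjoint U) $$ (i,j) = 1\<^sub>m n $$ (i,j)" using assms by (simp add: unitary_def)
  then show ?thesis using assms U by (subst (asm) mult_mat_index[where m=n]) auto
qed

lemma unitary_cols:
  assumes "unitary n U" "i < n" "j < n"
  shows "(\<Sum>k<n. cnj (U $$ (k,i)) * U $$ (k,j)) = (if i = j then 1 else 0)"
proof -
  have U: "U \<in> carrier_mat n n" using assms by (simp add: unitary_def)
  have "(adjoint U * U) $$ (i,j) = 1\<^sub>m n $$ (i,j)" using assms by (simp add: unitary_def)
  then show ?thesis using assms U by (subst (asm) mult_mat_index[where m=n]) auto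
qed

text \<open>A right inverse of a square matrix is also a left inverse, so orthonormal rows give
  orthonormal columns.\<close>

lemma unitaryI_rows:
  assumes "U \<in> carrier_mat n n"
    and "\<And>i j. i < n \<Longrightarrow> j < n \<Longrightarrow> (\<Sum>k<n. U $$ (i,k) * cnj (U $$ (j,k))) = (if i = j then 1 else 0)"
  shows "unitary n U"
proof -
  have "U * adjoint U = 1\<^sub>m n"
    by (rule eq_matI) (use assms in \<open>auto simp: mult_mat_index[where m=n and n=n and p=n] simp del: index_mult_mat(1)\<close>)
  moreover from this have "adjoint U * U = 1\<^sub>m n"
    by (rule mat_mult_left_right_inverse[OF assms(1) adjoint_carrier[OF assms(1)]])
  ultimately show ?thesis using assms by (simp add: unitary_def)
qed

lemma unitary_mult:
  assumes "unitary n U" "unitary n V"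
  shows "unitary n (U * V)"
proof -
  have C: "U \<in> carrier_mat n n" "V \<in> carrier_mat n n" using assms by (auto simp: unitary_def)
  have "U * V * adjoint (U * V) = U * (V * adjoint V) * adjoint U"
    using C by (simp add: adjoint_mult[OF C] adjoint_carrier[where n=n and m=n] mult_carrier_mat[where n=n and nr=n and nc=n] assoc_mult_mat[where ?n\<^sub>1=n and ?n\<^sub>2=n and ?n\<^sub>3=n and ?n\<^sub>4=n])
  also have "\<dots> = 1\<^sub>m n" using assms C by (simp add: unitary_def)
  finally have r: "U * V * adjoint (U * V) = 1\<^sub>m n" .
  moreover from this have "adjoint (U * V) * (U * V) = 1\<^sub>m n"
    by (rule mat_mult_left_right_inverse[OF mult_carrier_mat[OF C] adjoint_carrier[OF mult_carrier_mat[OF C]]])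
  ultimately show ?thesis using C by (simp add: unitary_def)
qed

lemma spec_mat_mult_left:
  assumes "U \<in> carrier_mat n n" "V \<in> carrier_mat n n"
  shows "spec_mat n (U * V) f = U * spec_mat n V f * adjoint U"
proof -
  let ?D = "diag_of n (\<lambda>i. complex_of_real (f i))"
  have "?D \<in> carrier_mat n n" by simp
  with assms show ?thesis
    unfolding spec_mat_def
    by (simp add: adjoint_mult[OF assms] adjoint_carrier[where n=n and m=n] mult_carrier_mat[where n=n and nr=n and nc=n] assoc_mult_mat[where ?n\<^sub>1=n and ?n\<^sub>2=n and ?n\<^sub>3=n and ?n\<^sub>4=n])
qed

text \<open>A Householder reflection; the sign condition keeps the denominator away from 0.\<close>
lemma householder:
  fixes v :: "nat \<Rightarrow> complex" and r :: real
  assumes n: "0 < n" and norm: "(\<Sum>i<n. v i * cnj (v i)) = 1" and v0: "v 0 = of_real r" "r \<le> 0"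
  obtains H where "unitary n H" "hermitian H" "\<And>i. i < n \<Longrightarrow> H $$ (i,0) = v i"
proof -
  \<comment> \<open>The reflection exchanges \<open>v\<close> and the basis vector e_0, so its
    normal is \<open>w\<close> = v - e_0. For a unit vector with real entry r at 0, |w|^2 = 2 (1 -
    r), and \<open>c\<close> is 2 / |w|^2.\<close>
  define w where "w i = v i - (if i = 0 then 1 else 0)" for i
  define c where "c = complex_of_real (1 / (1 - r))"
  define H where "H = mat n n (\<lambda>(i,j). (if i = j then 1 else 0) - c * w i * cnj (w j))"
  have c: "c * (1 - of_real r) = 1" "cnj c = c"
  proof -
    have "c * (1 - of_real r) = of_real (1 / (1 - r) * (1 - r))" unfolding c_def by (simp only: of_real_mult of_real_diff of_real_1)
    then show "c * (1 - of_real r) = 1" using v0 by simp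
  qed (simp add: c_def)
  have C: "H \<in> carrier_mat n n" by (simp add: H_def)
  have "(\<Sum>i<n. w i * cnj (w i)) = (\<Sum>i<n. v i * cnj (v i) - (if i = 0 then v i else 0) - (if i = 0 then cnj (v i) else 0) + (if i = 0 then 1 else 0))"
    by (intro sum.cong) (auto simp: w_def algebra_simps)
  also have "\<dots> = 2 * (1 - of_real r)"
    using n norm v0 by (simp add: sum.distrib sum_subtractf)
  finally have ww: "c * (\<Sum>i<n. w i * cnj (w i)) = 2" using c(1) by (simp only: mult.left_commute[of c 2] mult_1_right)
  have herm: "hermitian H"
    by (subst hermitian_iff[OF C]) (auto simp: H_def c(2) mult_ac)
  have unit: "unitary n H"
  proof (rule unitaryI_rows[OF C])
    fix i j assume ij: "i < n" "j < n"
    have "(\<Sum>k<n. H $$ (i,k) * cnj (H $$ (j,k))) =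
       (\<Sum>k<n. (if k = i then 1 else 0) * (if k = j then 1 else 0)
           - (if k = i then 1 else 0) * (c * cnj (w j) * w k)
           - (if k = j then 1 else 0) * (c * w i * cnj (w k))
           + c * w i * cnj (w j) * (c * (w k * cnj (w k))))"
      by (intro sum.cong) (use ij in \<open>auto simp: H_def c(2) algebra_simps\<close>)
    also have "\<dots> = (if i = j then 1 else 0) - c * cnj (w j) * w i - c * w i * cnj (w j)
          + c * w i * cnj (w j) * (c * (\<Sum>k<n. w k * cnj (w k)))"
      using ij by (simp only: sum.distrib sum_subtractf sum_if_eq_left sum_distrib_left[symmetric] finite_lessThan) simp
    also have "\<dots> = (if i = j then 1 else 0)" unfolding ww by (simp add: mult_ac)
    finally show "(\<Sum>k<n. H $$ (i,k) * cnj (H $$ (j,k))) = (if i = j then 1 else 0)" .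
  qed
  have "H $$ (i,0) = v i" if i: "i < n" for i
  proof -
    have "H $$ (i,0) = (if i = 0 then 1 else 0) - w i * (c * cnj (w 0))"
    using i n by (simp add: H_def)
  also have "c * cnj (w 0) = - (c * (1 - of_real r))" by (simp add: w_def v0 algebra_simps)
  finally show "H $$ (i,0) = v i" by (simp add: c(1) w_def)
  qed
  with unit herm show thesis by (rule that)
qed

text \<open>An eigenvalue exists because the spectrum over the complex numbers is nonempty. The
  eigenvector may be rescaled freely: the modulus of the factor makes it a unit vector, the phase
  gives the entry at 0 the sign that \<open>householder\<close> asks for.\<close>

lemma unit_eigenvector:
  assumes A: "A \<in> carrier_mat n n" and n: "0 < n"
  obtains l v r where "\<And>i. i < n \<Longrightarrow> (\<Sum>j<n. A $$ (i,j) * v j) = l * v i"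
    "(\<Sum>i<n. v i * cnj (v i)) = 1" "v 0 = of_real r" "r \<le> 0"
proof -
  from spectrum_non_empty[OF A n] obtain l x where "eigenvector A x l"
    by (auto simp: spectrum_def eigenvalue_def)
  then have x: "x \<in> carrier_vec n" "x \<noteq> 0\<^sub>v n" and ev: "A *\<^sub>v x = l \<cdot>\<^sub>v x"
    using A by (auto simp: eigenvector_def)
  have evx: "(\<Sum>j<n. A $$ (i,j) * x $ j) = l * x $ i" if "i < n" for i
    using mult_mat_vec_index[OF A x(1) that] ev x that by simp
  define N where "N = (\<Sum>i<n. (cmod (x $ i))\<^sup>2)"
  obtain i0 where i0: "i0 < n" "x $ i0 \<noteq> 0" using x by (metis eq_vecI carrier_vecD index_zero_vec)
  have N: "N > 0" unfolding N_def
    by (rule sum_pos2[of _ i0]) (use i0 in auto)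
  \<comment> \<open>The phase that turns \<open>x $ 0\<close> into minus its modulus; when that
    entry vanishes every phase does, and 1 is taken.\<close>
  define p where "p = (if x $ 0 = 0 then 1 else - cnj (x $ 0) / cmod (x $ 0))"
  have p: "p * cnj p = 1"
    unfolding p_def by (auto simp: norm_divide complex_norm_square[symmetric] power2_eq_square field_simps simp flip: of_real_mult)
  have px: "p * x $ 0 = of_real (- cmod (x $ 0))"
    unfolding p_def using complex_norm_square[of "x $ 0"] by (auto simp: power2_eq_square field_simps)
  define q where "q = p * complex_of_real (1 / sqrt N)"
  define v where "v i = q * x $ i" for i
  have q: "q * cnj q = of_real (1 / N)"
  proof -
    have "q * cnj q = (p * cnj p) * of_real ((1 / sqrt N) * (1 / sqrt N))" by (simp only: q_def complex_cnj_mult complex_cnj_complex_of_real of_real_mult mult_ac)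
    also have "(1 / sqrt N) * (1 / sqrt N) = 1 / N" using N by simp
    finally show ?thesis by (simp only: p mult_1_left)
  qed
  show ?thesis
  proof
    show "(\<Sum>j<n. A $$ (i,j) * v j) = l * v i" if "i < n" for i
    proof -
      have "(\<Sum>j<n. A $$ (i,j) * v j) = q * (\<Sum>j<n. A $$ (i,j) * x $ j)"
        unfolding v_def sum_distrib_left by (intro sum.cong) auto
      then show ?thesis using evx[OF that] by (simp add: v_def)
    qed
    have "(\<Sum>i<n. v i * cnj (v i)) = (q * cnj q) * of_real N"
      unfolding N_def of_real_sum sum_distrib_left v_def
      by (intro sum.cong) (simp_all only: complex_norm_square complex_cnj_mult mult_ac)
    then show "(\<Sum>i<n. v i * cnj (v i)) = 1" using N by (simp add: q)
    show "v 0 = of_real (- cmod (x $ 0) / sqrt N)"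
      using px by (simp add: v_def q_def mult.commute mult.left_commute)
    show "- cmod (x $ 0) / sqrt N \<le> 0" using N by simp
  qed
qed

text \<open>Deflation: conjugating by a reflection whose first column is a unit eigenvector makes
  the first column of the matrix a multiple of e_0. Hermitian symmetry clears the first row as well,
  and the remaining block is hermitian of one dimension less.\<close>

theorem spectral_theorem:
  assumes "A \<in> carrier_mat n n" "hermitian A"
  obtains U d where "unitary n U" "A = spec_mat n U d"
proof -
  have "\<exists>U d. unitary n U \<and> A = spec_mat n U d"
    using assms
  proof (induction n arbitrary: A)
    case 0
    show ?case
      by (rule exI[of _ "1\<^sub>m 0"], rule exI[of _ "\<lambda>_. 0"])
        (use 0 in \<open>auto simp: unitary_def spec_mat_def intro!: eq_matI\<close>)
  next
    case (Suc n)
    let ?N = "Suc n"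
    obtain l v r where ev: "\<And>i. i < ?N \<Longrightarrow> (\<Sum>j<?N. A $$ (i,j) * v j) = l * v i"
      and v: "(\<Sum>i<?N. v i * cnj (v i)) = 1" "v 0 = of_real r" "r \<le> 0"
      by (rule unit_eigenvector[OF Suc.prems(1)]) blast+
    obtain H where H: "unitary ?N H" "hermitian H" "\<And>i. i < ?N \<Longrightarrow> H $$ (i,0) = v i"
      by (rule householder[of ?N v r]) (use v in auto)
    have HC: "H \<in> carrier_mat ?N ?N" using H by (simp add: unitary_def)
    have HA: "adjoint H = H" using H by (simp add: hermitian_def)
    have HH: "H * H = 1\<^sub>m ?N" using H HA by (simp add: unitary_def)
    note [simp] = assoc_mult_mat[where ?n\<^sub>1="Suc n" and ?n\<^sub>2="Suc n" and ?n\<^sub>3="Suc n" and ?n\<^sub>4="Suc n"]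
    have AC: "A \<in> carrier_mat ?N ?N" by fact
    define B where "B = H * (A * H)"
    have AHC: "A * H \<in> carrier_mat ?N ?N" using AC HC by simp
    have BC: "B \<in> carrier_mat ?N ?N" unfolding B_def using HC AHC by simp
    have "adjoint B = B"
      using Suc.prems(2) HC AC unfolding B_def
      by (simp add: adjoint_mult[OF HC AHC] adjoint_mult[OF AC HC] HA hermitian_def)
    then have Bh: "hermitian B" using BC by (auto simp: hermitian_def)
    have "A * H = H * B"
    proof -
      have "H * B = (H * H) * (A * H)" unfolding B_def using HC AHC AC by simp
      then show ?thesis by (metis HH AHC left_mult_one_mat)
    qed
    have "H * B * H = (H * H) * A * (H * H)" unfolding B_def using HC AC AHC by simp
    then have AB: "A = H * B * adjoint H" using HH HA AC by simp
    \<comment> \<open>Column 0 of \<open>H\<close> is the eigenvector, so \<open>A * H\<close>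
      scales it by \<open>l\<close>; the outer \<open>H\<close>, being its own inverse, sends it
      back to e_0.\<close>
    have B0: "B $$ (i,0) = (if i = 0 then l else 0)" if "i < ?N" for i
    proof -
      have "(A * H) $$ (j,0) = l * H $$ (j,0)" if "j < ?N" for j
      proof -
        have "(A * H) $$ (j,0) = (\<Sum>k<?N. A $$ (j,k) * H $$ (k,0))"
          using that by (intro mult_mat_index[OF AC HC]) auto
        also have "\<dots> = (\<Sum>k<?N. A $$ (j,k) * v k)" by (intro sum.cong) (auto simp: H(3))
        finally show ?thesis using ev[OF that] H(3)[OF that] by simp
      qed
      then have "B $$ (i,0) = l * (\<Sum>j<?N. H $$ (i,j) * H $$ (j,0))"
        unfolding B_def sum_distrib_left using that
        by (subst mult_mat_index[OF HC AHC]) (auto intro!: sum.cong)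
      also have "(\<Sum>j<?N. H $$ (i,j) * H $$ (j,0)) = (H * H) $$ (i,0)"
        using that by (subst mult_mat_index[OF HC HC]) auto
      finally show ?thesis using that by (simp add: HH)
    qed
    note Bs = Bh[unfolded hermitian_iff[OF BC], rule_format]
    \<comment> \<open>The eigenvalue is real because it is a diagonal entry of the hermitian matrix
      \<open>B\<close>.\<close>
    have l: "of_real (Re l) = l"
      using Bs[of 0 0] B0[of 0] by (simp add: complex_eq_iff)
    have B0': "B $$ (0,i) = (if i = 0 then l else 0)" if "i < ?N" for i
      using Bs[of 0 i] B0[OF that] that B0[of 0] by (auto split: if_splits)
    define B1 where "B1 = mat n n (\<lambda>(i,j). B $$ (Suc i, Suc j))"
    have B1C: "B1 \<in> carrier_mat n n" by (simp add: B1_def)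
    have "hermitian B1"
      by (subst hermitian_iff[OF B1C]) (auto simp: B1_def intro!: Bs)
    from Suc.IH[OF B1C this] obtain U1 d1 where U1: "unitary n U1" "B1 = spec_mat n U1 d1" by blast
    \<comment> \<open>The block sum of 1 and \<open>U1\<close>. The case distinction catches index 0
      before the truncated \<open>i - 1\<close> could misread it.\<close>
    define U where "U = mat ?N ?N (\<lambda>(i,j). if i = 0 \<or> j = 0 then (if i = j then 1 else 0) else U1 $$ (i - 1, j - 1))"
    define d where "d i = (if i = 0 then Re l else d1 (i - 1))" for i
    have UC: "U \<in> carrier_mat ?N ?N" by (simp add: U_def)
    have U1C: "U1 \<in> carrier_mat n n" using U1 by (simp add: unitary_def)
    have U00: "U $$ (0,0) = 1" by (simp add: U_def)
    have U0: "U $$ (0, Suc i) = 0" "U $$ (Suc i, 0) = 0" if "i < n" for i using that by (auto simp: U_def)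
    have US: "U $$ (Suc i, Suc j) = U1 $$ (i,j)" if "i < n" "j < n" for i j using that by (auto simp: U_def)
    have Uu: "unitary ?N U"
    proof (rule unitaryI_rows[OF UC])
      fix i j assume "i < ?N" "j < ?N"
      then show "(\<Sum>k<?N. U $$ (i,k) * cnj (U $$ (j,k))) = (if i = j then 1 else 0)"
        unfolding sum.lessThan_Suc_shift
        by (cases i; cases j) (simp_all add: U00 U0 US unitary_rows[OF U1(1)])
    qed
    have "B = spec_mat ?N U d"
    proof (rule eq_matI)
      fix i j assume "i < dim_row (spec_mat ?N U d)" "j < dim_col (spec_mat ?N U d)"
      then have ij: "i < ?N" "j < ?N" using spec_mat_carrier[OF UC, of d] by auto
      have B1e: "B $$ (Suc i, Suc j) = (\<Sum>k<n. d1 k * U1 $$ (i,k) * cnj (U1 $$ (j,k)))" if "i < n" "j < n" for i j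
      proof -
        have "B $$ (Suc i, Suc j) = B1 $$ (i,j)" using that by (simp add: B1_def)
        then show ?thesis using that by (simp add: U1(2) spec_mat_index[OF U1C])
      qed
      show "B $$ (i,j) = spec_mat ?N U d $$ (i,j)"
      proof (cases "i = 0 \<or> j = 0")
        case True
        then show ?thesis unfolding spec_mat_index[OF UC ij] sum.lessThan_Suc_shift
          using ij B0[of i] B0'[of j] by (cases i; cases j) (simp_all add: U00 U0 d_def l)
      next
        case False
        then obtain i' j' where "i = Suc i'" "j = Suc j'" by (metis not0_implies_Suc)
        then show ?thesis unfolding spec_mat_index[OF UC ij] sum.lessThan_Suc_shift
          using ij by (simp add: U0 US d_def B1e)
      qed
    qed (use BC spec_mat_carrier[OF UC, of d] in auto)
    then have "A = spec_mat ?N (H * U) d"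
      using AB by (simp only: spec_mat_mult_left[OF HC UC])
    then show ?case using unitary_mult[OF H(1) Uu] by blast
  qed
  then show ?thesis using that by blast
qed


section \<open>Quadratic forms in an eigenbasis\<close>

text \<open>Entry \<open>k\<close> of the adjoint of \<open>U\<close> applied to \<open>v\<close>:
  the coordinate of \<open>v\<close> along column \<open>k\<close> of \<open>U\<close>.\<close>

definition coef :: "nat \<Rightarrow> complex mat \<Rightarrow> (nat \<Rightarrow> complex) \<Rightarrow> nat \<Rightarrow> complex" where
  "coef n U v k = (\<Sum>i<n. cnj (U $$ (i,k)) * v i)"

text \<open>The form \<open>qform\<close> on functions instead of \<open>vec\<close>: only the
  values below \<open>n\<close> count, and slices or product vectors can be written as plain lambda
  terms without carrier conditions.\<close>

definition hform :: "nat \<Rightarrow> complex mat \<Rightarrow> (nat \<Rightarrow> complex) \<Rightarrow> complex" where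
  "hform n A v = (\<Sum>i<n. \<Sum>j<n. cnj (v i) * A $$ (i,j) * v j)"

lemma qform_eq_hform:
  assumes "A \<in> carrier_mat n n" "v \<in> carrier_vec n"
  shows "qform A v = hform n A (\<lambda>i. v $ i)"
  using assms by (auto simp: qform_def hform_def mult_mat_vec_index sum_distrib_left mult.assoc
      simp del: index_mult_mat_vec intro!: sum.cong)

lemma hform_cong: "(\<And>i. i < n \<Longrightarrow> v i = w i) \<Longrightarrow> hform n A v = hform n A w"
  by (simp add: hform_def)

lemma hform_eq_qform: "A \<in> carrier_mat n n \<Longrightarrow> hform n A v = qform A (vec n v)"
  by (subst qform_eq_hform) (auto intro: hform_cong)

lemma hform_diff:
  assumes "A \<in> carrier_mat n n" "B \<in> carrier_mat n n"
  shows "hform n (A - B) v = hform n A v - hform n B v"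
  using assms by (auto simp: hform_def algebra_simps simp flip: sum_subtractf intro!: sum.cong)

lemma Im_hform_hermitian:
  assumes "A \<in> carrier_mat n n" "hermitian A"
  shows "Im (hform n A v) = 0"
proof -
  have "cnj (hform n A v) = (\<Sum>i<n. \<Sum>j<n. cnj (v j) * cnj (A $$ (i,j)) * v i)"
    by (simp add: hform_def mult_ac)
  also have "\<dots> = (\<Sum>j<n. \<Sum>i<n. cnj (v j) * cnj (A $$ (i,j)) * v i)" by (rule sum.swap)
  also have "\<dots> = hform n A v"
    using assms(2)[unfolded hermitian_iff[OF assms(1)]] by (simp add: hform_def)
  finally show ?thesis by (simp add: complex_eq_iff)
qed

lemma psdI:
  assumes "A \<in> carrier_mat n n" "hermitian A" "\<And>v. 0 \<le> Re (hform n A v)"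
  shows "psd A"
  using assms by (auto simp: psd_def qform_eq_hform[where n=n] Im_hform_hermitian)

lemma pos_def_hform:
  assumes A: "A \<in> carrier_mat n n" and pd: "pos_def A" and "i < n" "v i \<noteq> 0"
  shows "0 < Re (hform n A v)"
proof -
  have "vec n v \<noteq> 0\<^sub>v n"
    using assms(3,4) by (metis index_vec index_zero_vec(1))
  then show ?thesis using assms by (auto simp: hform_eq_qform pos_def_def)
qed

lemma pos_def_hform_nonneg:
  assumes A: "A \<in> carrier_mat n n" and pd: "pos_def A"
  shows "0 \<le> Re (hform n A v)"
proof (cases "\<exists>i<n. v i \<noteq> 0")
  case True
  then show ?thesis using pos_def_hform[OF assms] by force
next
  case False
  then show ?thesis by (simp add: hform_def)
qed

lemma pos_defI:
  assumes "A \<in> carrier_mat n n" "hermitian A" "\<And>v i. i < n \<Longrightarrow> v i \<noteq> 0 \<Longrightarrow> 0 < Re (hform n A v)"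
  shows "pos_def A"
proof -
  have "0 < Re (hform n A (\<lambda>i. v $ i))" if "v \<in> carrier_vec n" "v \<noteq> 0\<^sub>v n" for v
  proof -
    have "\<exists>i<n. v $ i \<noteq> 0"
    proof (rule ccontr)
      assume "\<not> ?thesis"
      then have "v = 0\<^sub>v n" using that(1) by (intro eq_vecI) auto
      with that(2) show False by simp
    qed
    then obtain i where "i < n" "v $ i \<noteq> 0" by blast
    then show ?thesis using assms(3)[of i "\<lambda>i. v $ i"] by blast
  qed
  then show ?thesis
    using assms by (auto simp: pos_def_def qform_eq_hform[where n=n] Im_hform_hermitian)
qed

lemma hform_spec_mat:
  assumes "U \<in> carrier_mat n n"
  shows "hform n (spec_mat n U f) v = of_real (\<Sum>k<n. f k * (cmod (coef n U v k))\<^sup>2)"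
proof -
  have "hform n (spec_mat n U f) v
      = (\<Sum>i<n. \<Sum>j<n. \<Sum>k<n. f k * ((cnj (v i) * U $$ (i,k)) * (cnj (U $$ (j,k)) * v j)))"
    unfolding hform_def
    by (intro sum.cong refl)
       (auto simp: spec_mat_index[OF assms] sum_distrib_left sum_distrib_right mult_ac intro!: sum.cong)
  also have "\<dots> = (\<Sum>i<n. \<Sum>k<n. \<Sum>j<n. f k * ((cnj (v i) * U $$ (i,k)) * (cnj (U $$ (j,k)) * v j)))"
    by (intro sum.cong refl sum.swap)
  also have "\<dots> = (\<Sum>k<n. \<Sum>i<n. \<Sum>j<n. f k * ((cnj (v i) * U $$ (i,k)) * (cnj (U $$ (j,k)) * v j)))"
    by (rule sum.swap)
  also have "\<dots> = (\<Sum>k<n. f k * (cnj (coef n U v k) * coef n U v k))"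
    unfolding coef_def cnj_sum sum_product
    by (auto simp: sum_distrib_left mult_ac intro!: sum.cong)
  also have "\<dots> = of_real (\<Sum>k<n. f k * (cmod (coef n U v k))\<^sup>2)"
    unfolding of_real_sum of_real_mult complex_norm_square by (simp add: mult_ac)
  finally show ?thesis .
qed

lemma coef_diff: "coef n U (\<lambda>i. v i - w i) k = coef n U v k - coef n U w k"
  by (simp add: coef_def algebra_simps sum_subtractf)

text \<open>Orthonormality of the columns. It allows a vector to be prescribed by its
  eigencoordinates, which is how the test vectors and minimisers below are built.\<close>

lemma coef_synthesis:
  assumes "unitary n U" "k < n"
  shows "coef n U (\<lambda>i. \<Sum>l<n. U $$ (i,l) * c l) k = c k"
proof -
  have "coef n U (\<lambda>i. \<Sum>l<n. U $$ (i,l) * c l) k = (\<Sum>i<n. \<Sum>l<n. cnj (U $$ (i,k)) * U $$ (i,l) * c l)"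
    by (simp add: coef_def sum_distrib_left mult.assoc)
  also have "\<dots> = (\<Sum>l<n. (\<Sum>i<n. cnj (U $$ (i,k)) * U $$ (i,l)) * c l)"
    by (subst sum.swap) (simp add: sum_distrib_right)
  also have "\<dots> = (\<Sum>l<n. (if k = l then 1 else 0) * c l)"
    using assms by (intro sum.cong refl) (simp add: unitary_cols)
  also have "\<dots> = c k" using assms by (simp add: if_distrib[of "\<lambda>x. x * _"] cong: if_cong)
  finally show ?thesis .
qed

lemma parseval:
  assumes "unitary n U"
  shows "(\<Sum>k<n. cnj (coef n U v k) * coef n U w k) = (\<Sum>i<n. cnj (v i) * w i)"
proof -
  have "(\<Sum>k<n. cnj (coef n U v k) * coef n U w k)
      = (\<Sum>k<n. \<Sum>i<n. \<Sum>j<n. (U $$ (i,k) * cnj (U $$ (j,k))) * (cnj (v i) * w j))"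
    unfolding coef_def cnj_sum sum_product by (simp add: mult_ac)
  also have "\<dots> = (\<Sum>i<n. \<Sum>k<n. \<Sum>j<n. (U $$ (i,k) * cnj (U $$ (j,k))) * (cnj (v i) * w j))"
    by (rule sum.swap)
  also have "\<dots> = (\<Sum>i<n. \<Sum>j<n. \<Sum>k<n. (U $$ (i,k) * cnj (U $$ (j,k))) * (cnj (v i) * w j))"
    by (intro sum.cong refl sum.swap)
  also have "\<dots> = (\<Sum>i<n. \<Sum>j<n. (if i = j then 1 else 0) * (cnj (v i) * w j))"
    using assms by (intro sum.cong refl) (simp add: unitary_rows flip: sum_distrib_right)
  also have "\<dots> = (\<Sum>i<n. cnj (v i) * w i)"
    by (simp add: if_distrib[of "\<lambda>x. x * _"] cong: if_cong)
  finally show ?thesis .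
qed

lemma parseval_norm:
  assumes "unitary n U"
  shows "(\<Sum>k<n. (cmod (coef n U v k))\<^sup>2) = (\<Sum>i<n. (cmod (v i))\<^sup>2)"
proof -
  have "complex_of_real (\<Sum>k<n. (cmod (coef n U v k))\<^sup>2) = of_real (\<Sum>i<n. (cmod (v i))\<^sup>2)"
    using parseval[OF assms, of v v] unfolding of_real_sum complex_norm_square by (simp add: mult.commute)
  then show ?thesis by (simp only: of_real_eq_iff)
qed

text \<open>The form is tested on column \<open>k\<close> of \<open>U\<close>, whose only nonzero
  eigencoordinate is a 1 at \<open>k\<close>. Its norm is 1, so it is not the zero vector, and the
  value of the form is \<open>d k\<close>.\<close>

lemma spec_mat_pos:
  assumes U: "unitary n U" and pd: "pos_def (spec_mat n U d)" and k: "k < n"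
  shows "0 < d k"
proof -
  note UC = unitary_carrier[OF U]
  define v where "v i = (\<Sum>l<n. U $$ (i,l) * (if l = k then 1 else 0))" for i
  have c: "coef n U v l = (if l = k then 1 else 0)" if "l < n" for l
    unfolding v_def by (rule coef_synthesis[OF U that])
  have "(\<Sum>i<n. (cmod (v i))\<^sup>2) = (\<Sum>l<n. (cmod (if l = k then 1 else 0))\<^sup>2)"
    unfolding parseval_norm[OF U, of v, symmetric] by (intro sum.cong) (auto simp: c)
  also have "\<dots> = 1" using k by (simp add: if_distrib[of "\<lambda>x. (cmod x)\<^sup>2"] cong: if_cong)
  finally have "\<exists>i<n. v i \<noteq> 0" by (force intro: ccontr)
  then have "0 < Re (hform n (spec_mat n U d) v)"
    using pos_def_hform[OF spec_mat_carrier[OF UC] pd] by blast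
  also have "\<dots> = (\<Sum>l<n. d l * (if l = k then 1 else 0))"
    unfolding hform_spec_mat[OF UC] Re_complex_of_real by (intro sum.cong) (auto simp: c)
  also have "\<dots> = d k" using k by (simp add: if_distrib[of "\<lambda>x. _ * x"] cong: if_cong)
  finally show ?thesis .
qed

text \<open>The predicate under the choice in \<open>mpow\<close> does not mention the exponent, so
  one pair \<open>U\<close>, \<open>d\<close> serves the matrix and all its powers. The spectral
  theorem shows that the predicate is satisfiable.\<close>

lemma mpow_spectral:
  assumes A: "A \<in> carrier_mat n n" and pd: "pos_def A"
  obtains U d where "unitary n U" "\<And>i. i < n \<Longrightarrow> 0 < d i" "A = spec_mat n U d"
    "\<And>t. mpow A t = spec_mat n U (\<lambda>i. d i powr t)"
proof -
  let ?P = "\<lambda>(U, d). unitary n U \<and> (\<forall>i<n. d i > (0::real)) \<and>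
                   A = U * diag_of n (\<lambda>i. complex_of_real (d i)) * adjoint U"
  obtain U0 d0 where "unitary n U0" "A = spec_mat n U0 d0"
    using spectral_theorem[OF A] pd by (auto simp: pos_def_def)
  then have "?P (U0, d0)" using spec_mat_pos[of n U0 d0] pd by (auto simp: spec_mat_def)
  then have P: "?P (SOME x. ?P x)" by (rule someI)
  obtain U d where Ud: "(SOME x. ?P x) = (U, d)" by (cases "SOME x. ?P x") auto
  have n: "dim_row A = n" using A by simp
  show ?thesis
  proof
    show "unitary n U" "A = spec_mat n U d" using P unfolding Ud by (auto simp: spec_mat_def)
    show "0 < d i" if "i < n" for i using P that unfolding Ud by auto
    show "mpow A t = spec_mat n U (\<lambda>i. d i powr t)" for t
      unfolding mpow_def Let_def n Ud by (simp add: spec_mat_def)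
  qed
qed

section \<open>Operator monotonicity of powers\<close>

text \<open>As a function of \<open>y\<close> the right-hand side is minimal at y = a x / (a + t),
  where it equals the left-hand side. Multiplied by a + t, the gap is the square |a x - (a + t)
  y|^2.\<close>

lemma parallel_sum_le:
  fixes x y :: complex
  assumes "0 < a" "0 < t"
  shows "t * (a / (a + t) * (cmod x)\<^sup>2) \<le> a * (cmod (x - y))\<^sup>2 + t * (cmod y)\<^sup>2"
proof -
  have "(a + t) * (a * (cmod (x - y))\<^sup>2 + t * (cmod y)\<^sup>2) - t * a * (cmod x)\<^sup>2
      = (cmod (of_real a * x - of_real (a + t) * y))\<^sup>2"
    unfolding cmod_power2 by (simp add: power2_eq_square algebra_simps)
  then have "t * a * (cmod x)\<^sup>2 \<le> (a + t) * (a * (cmod (x - y))\<^sup>2 + t * (cmod y)\<^sup>2)"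
    by (metis diff_ge_0_iff_ge zero_le_power2)
  then show ?thesis using assms by (simp add: field_simps)
qed

lemma parallel_sum_eq:
  fixes x :: complex
  assumes "0 < a" "0 < t"
  shows "a * (cmod (x - of_real (a / (a + t)) * x))\<^sup>2 + t * (cmod (of_real (a / (a + t)) * x))\<^sup>2
    = t * (a / (a + t) * (cmod x)\<^sup>2)"
proof -
  have "x - of_real (a / (a + t)) * x = of_real (1 - a / (a + t)) * x" by (simp add: algebra_simps)
  also have "1 - a / (a + t) = t / (a + t)" using assms by (simp add: field_simps)
  finally have "a * (cmod (x - of_real (a / (a + t)) * x))\<^sup>2 + t * (cmod (of_real (a / (a + t)) * x))\<^sup>2
    = (a * (t / (a + t))\<^sup>2 + t * (a / (a + t))\<^sup>2) * (cmod x)\<^sup>2"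
    by (simp only: norm_mult norm_of_real power_mult_distrib power2_abs) (simp add: algebra_simps)
  also have "a * (t / (a + t))\<^sup>2 + t * (a / (a + t))\<^sup>2 = t * (a / (a + t))"
    using assms by (simp add: divide_simps power2_eq_square) (simp add: algebra_simps)
  finally show ?thesis by simp
qed

text \<open>The resolvent form is the infimum over \<open>y\<close> of the form of the matrix at \<open>v - y\<close> plus
  \<open>t\<close> times the squared norm of \<open>y\<close>, which is visibly monotone in the matrix.\<close>
lemma resolvent_mono:
  assumes U: "unitary n U" and V: "unitary n V"
    and a: "\<And>i. i < n \<Longrightarrow> 0 < a i" and b: "\<And>i. i < n \<Longrightarrow> 0 < b i"
    and le: "\<And>v. Re (hform n (spec_mat n U a) v) \<le> Re (hform n (spec_mat n V b) v)"
    and t: "0 < t"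
  shows "(\<Sum>k<n. (cmod (coef n U v k))\<^sup>2 * (a k / (a k + t))) \<le> (\<Sum>k<n. (cmod (coef n V v k))\<^sup>2 * (b k / (b k + t)))"
proof -
  \<comment> \<open>The minimiser for the larger matrix, B (B + t)^(-1) v in terms of operators. The
    bound for the smaller matrix holds at every \<open>y\<close>, hence at this one, where the bound
    for the larger one is attained.\<close>
  define y where "y i = (\<Sum>l<n. V $$ (i,l) * (of_real (b l / (b l + t)) * coef n V v l))" for i
  have cy: "coef n V y k = of_real (b k / (b k + t)) * coef n V v k" if "k < n" for k
    unfolding y_def by (rule coef_synthesis[OF V that])
  have "t * (\<Sum>k<n. (cmod (coef n U v k))\<^sup>2 * (a k / (a k + t)))
      \<le> (\<Sum>k<n. a k * (cmod (coef n U v k - coef n U y k))\<^sup>2 + t * (cmod (coef n U y k))\<^sup>2)"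
    unfolding sum_distrib_left
    by (intro sum_mono) (use parallel_sum_le[OF a t] in \<open>simp add: mult.commute\<close>)
  also have "\<dots> = Re (hform n (spec_mat n U a) (\<lambda>i. v i - y i)) + t * (\<Sum>i<n. (cmod (y i))\<^sup>2)"
    by (simp only: hform_spec_mat[OF unitary_carrier[OF U]] Re_complex_of_real coef_diff sum.distrib
        parseval_norm[OF U] sum_distrib_left[symmetric])
  also have "\<dots> \<le> Re (hform n (spec_mat n V b) (\<lambda>i. v i - y i)) + t * (\<Sum>i<n. (cmod (y i))\<^sup>2)"
    using le by simp
  also have "\<dots> = (\<Sum>k<n. b k * (cmod (coef n V v k - coef n V y k))\<^sup>2 + t * (cmod (coef n V y k))\<^sup>2)"
    by (simp only: hform_spec_mat[OF unitary_carrier[OF V]] Re_complex_of_real coef_diff sum.distrib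
        parseval_norm[OF V] sum_distrib_left[symmetric])
  also have "\<dots> = t * (\<Sum>k<n. (cmod (coef n V v k))\<^sup>2 * (b k / (b k + t)))"
    unfolding sum_distrib_left
  proof (intro sum.cong refl)
    fix k assume "k \<in> {..<n}"
    then have k: "k < n" by simp
    show "b k * (cmod (coef n V v k - coef n V y k))\<^sup>2 + t * (cmod (coef n V y k))\<^sup>2
      = t * ((cmod (coef n V v k))\<^sup>2 * (b k / (b k + t)))"
      unfolding cy[OF k] parallel_sum_eq[OF b[OF k] t] by (simp add: mult.commute)
  qed
  finally show ?thesis using t by simp
qed

text \<open>The integral converges only for 0 < s < 1, so the endpoints stand apart: at s = 0 both
  sides are the squared norm of \<open>v\<close> by Parseval, and s = 1 is the hypothesis.\<close>

theorem loewner_heinz: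
  assumes U: "unitary n U" and V: "unitary n V"
    and a: "\<And>i. i < n \<Longrightarrow> 0 < a i" and b: "\<And>i. i < n \<Longrightarrow> 0 < b i"
    and le: "\<And>v. Re (hform n (spec_mat n U a) v) \<le> Re (hform n (spec_mat n V b) v)"
    and s: "0 \<le> s" "s \<le> 1"
  shows "Re (hform n (spec_mat n U (\<lambda>i. a i powr s)) v) \<le> Re (hform n (spec_mat n V (\<lambda>i. b i powr s)) v)"
proof -
  note eqs = hform_spec_mat[OF unitary_carrier[OF U]] hform_spec_mat[OF unitary_carrier[OF V]] Re_complex_of_real
  consider "s = 0" | "s = 1" | "0 < s" "s < 1" using s by linarith
  then show ?thesis
  proof cases
    case 1
    have "(\<Sum>k<n. a k powr s * (cmod (coef n U v k))\<^sup>2) = (\<Sum>k<n. (cmod (coef n U v k))\<^sup>2)"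
      using a by (intro sum.cong) (auto simp: 1 less_imp_neq[symmetric])
    moreover have "(\<Sum>k<n. b k powr s * (cmod (coef n V v k))\<^sup>2) = (\<Sum>k<n. (cmod (coef n V v k))\<^sup>2)"
      using b by (intro sum.cong) (auto simp: 1 less_imp_neq[symmetric])
    ultimately show ?thesis unfolding eqs by (simp add: parseval_norm[OF U] parseval_norm[OF V])
  next
    case 2
    have "(\<Sum>k<n. a k powr s * (cmod (coef n U v k))\<^sup>2) = (\<Sum>k<n. a k * (cmod (coef n U v k))\<^sup>2)"
      using a by (intro sum.cong) (auto simp: 2 less_imp_le)
    moreover have "(\<Sum>k<n. b k powr s * (cmod (coef n V v k))\<^sup>2) = (\<Sum>k<n. b k * (cmod (coef n V v k))\<^sup>2)"
      using b by (intro sum.cong) (auto simp: 2 less_imp_le)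
    ultimately show ?thesis using le[of v] unfolding eqs by simp
  next
    case 3
    have "(\<Sum>k<n. (cmod (coef n U v k))\<^sup>2 * a k powr s) \<le> (\<Sum>k<n. (cmod (coef n V v k))\<^sup>2 * b k powr s)"
      by (rule sum_powr_le_of_resolvents[OF 3]) (auto intro: a b resolvent_mono[OF U V a b le] simp del: times_divide_eq_right)
    then show ?thesis unfolding eqs by (simp add: mult.commute)
  qed
qed


section \<open>Tensor products and partial traces\<close>

text \<open>The index \<open>a * m + b\<close> encodes the pair of tensor indices in the convention
  of \<open>kron\<close> and of both partial traces.\<close>

lemma sum_div_mod:
  fixes F :: "nat \<Rightarrow> 'a::comm_monoid_add"
  shows "(\<Sum>i<n*m. F i) = (\<Sum>a<n. \<Sum>b<m. F (a * m + b))"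
proof -
  have "(\<Sum>b<m. F (a * m + b)) = sum F {a*m..<a*m+m}" for a
    using sum.shift_bounds_nat_ivl[of F 0 "a*m" m] by (simp add: lessThan_atLeast0 add.commute)
  then show ?thesis by (simp add: sum.nat_group)
qed

lemma div_mod_index [simp]:
  fixes b m :: nat
  assumes "b < m"
  shows "(a * m + b) div m = a" "(a * m + b) mod m = b"
  using assms by auto

lemma index_less_mult: "a < n \<Longrightarrow> b < m \<Longrightarrow> a * m + b < n * (m::nat)"
  by (metis add_less_cancel_left less_le_trans mult_le_mono1 mult_Suc add.commute Suc_leI)

lemma div_mod_less:
  fixes i :: nat
  assumes "i < n * m"
  shows "i div m < n" "i mod m < m"
  using assms by (auto simp: less_mult_imp_div_less intro!: mod_less_divisor gr0I)

lemma kron_carrier [simp]: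
  "A \<in> carrier_mat n n \<Longrightarrow> B \<in> carrier_mat m m \<Longrightarrow> kron A B \<in> carrier_mat (n * m) (n * m)"
  by (auto simp: kron_def)

lemma kron_index:
  assumes "A \<in> carrier_mat n n" "B \<in> carrier_mat m m" "i < n * m" "j < n * m"
  shows "kron A B $$ (i,j) = A $$ (i div m, j div m) * B $$ (i mod m, j mod m)"
  using assms by (auto simp: kron_def)

lemma unitary_kron:
  assumes U: "unitary n U" and V: "unitary m V"
  shows "unitary (n * m) (kron U V)"
proof (rule unitaryI_rows)
  note C = unitary_carrier[OF U] unitary_carrier[OF V]
  show "kron U V \<in> carrier_mat (n * m) (n * m)" using C by simp
  fix i j assume ij: "i < n * m" "j < n * m"
  note d = div_mod_less[OF ij(1)] div_mod_less[OF ij(2)]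
  have "(\<Sum>k<n*m. kron U V $$ (i,k) * cnj (kron U V $$ (j,k)))
     = (\<Sum>a<n. \<Sum>b<m. (U $$ (i div m, a) * cnj (U $$ (j div m, a))) * (V $$ (i mod m, b) * cnj (V $$ (j mod m, b))))"
    unfolding sum_div_mod using ij
    by (intro sum.cong refl) (simp add: kron_index[OF C] index_less_mult)
  also have "\<dots> = (if i div m = j div m then 1 else 0) * (if i mod m = j mod m then 1 else 0)"
    unfolding sum_product[symmetric] using d by (simp add: unitary_rows[OF U] unitary_rows[OF V])
  also have "\<dots> = (if i = j then 1 else 0)" by (auto) (metis div_mult_mod_eq)
  finally show "(\<Sum>k<n*m. kron U V $$ (i,k) * cnj (kron U V $$ (j,k))) = (if i = j then 1 else 0)" .
qed

text \<open>Eigenvectors tensor and eigenvalues multiply. Through this both sides of the theorem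
  become powers of single spectral matrices.\<close>

lemma kron_spec_mat:
  assumes U: "U \<in> carrier_mat n n" and V: "V \<in> carrier_mat m m"
  shows "kron (spec_mat n U f) (spec_mat m V g)
    = spec_mat (n * m) (kron U V) (\<lambda>k. f (k div m) * g (k mod m))"
proof (rule eq_matI)
  note C = spec_mat_carrier[OF U, of f] spec_mat_carrier[OF V, of g]
  note K = kron_carrier[OF U V]
  show "dim_row (kron (spec_mat n U f) (spec_mat m V g)) = dim_row (spec_mat (n * m) (kron U V) (\<lambda>k. f (k div m) * g (k mod m)))"
    "dim_col (kron (spec_mat n U f) (spec_mat m V g)) = dim_col (spec_mat (n * m) (kron U V) (\<lambda>k. f (k div m) * g (k mod m)))"
    using carrier_matD[OF kron_carrier[OF C]]
      carrier_matD[OF spec_mat_carrier[OF K, of "\<lambda>k. f (k div m) * g (k mod m)"]] by simp_all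
  fix i j
  assume "i < dim_row (spec_mat (n * m) (kron U V) (\<lambda>k. f (k div m) * g (k mod m)))"
    "j < dim_col (spec_mat (n * m) (kron U V) (\<lambda>k. f (k div m) * g (k mod m)))"
  then have ij: "i < n * m" "j < n * m"
    using spec_mat_carrier[OF K, of "\<lambda>k. f (k div m) * g (k mod m)"] by auto
  note d = div_mod_less[OF ij(1)] div_mod_less[OF ij(2)]
  have "kron (spec_mat n U f) (spec_mat m V g) $$ (i,j)
    = (\<Sum>a<n. f a * U $$ (i div m, a) * cnj (U $$ (j div m, a))) * (\<Sum>b<m. g b * V $$ (i mod m, b) * cnj (V $$ (j mod m, b)))"
    using d by (simp add: kron_index[OF C ij] spec_mat_index[OF U] spec_mat_index[OF V])
  also have "\<dots> = (\<Sum>k<n*m. of_real (f (k div m) * g (k mod m)) * kron U V $$ (i,k) * cnj (kron U V $$ (j,k)))"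
    unfolding sum_product sum_div_mod using ij
    by (intro sum.cong refl) (simp add: kron_index[OF U V] index_less_mult)
  finally show "kron (spec_mat n U f) (spec_mat m V g) $$ (i,j)
     = spec_mat (n * m) (kron U V) (\<lambda>k. f (k div m) * g (k mod m)) $$ (i,j)"
    by (simp add: spec_mat_index[OF K ij])
qed

text \<open>Each rank-one term of \<open>B\<close> contracts the second tensor factor of
  \<open>x\<close> with \<open>\<phi> q\<close>, leaving the form of \<open>A\<close> at the
  contracted vector. The vectors may be any family, orthogonal or not: it is applied to the
  eigenvectors of \<open>sigma\<close> and also to their slices.\<close>

lemma hform_kron_rank_one_sum:
  assumes A: "A \<in> carrier_mat n n" and B: "B \<in> carrier_mat m m"
    and Bsum: "\<And>c c'. c < m \<Longrightarrow> c' < m \<Longrightarrow> B $$ (c,c') = (\<Sum>q\<in>Q. s q * \<phi> q c * cnj (\<phi> q c'))"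
  shows "hform (n * m) (kron A B) x = (\<Sum>q\<in>Q. s q * hform n A (\<lambda>i. \<Sum>c<m. cnj (\<phi> q c) * x (i * m + c)))"
proof -
  define T where "T i j c c' q = s q * ((\<phi> q c * cnj (x (i * m + c))) * A $$ (i,j) * (cnj (\<phi> q c') * x (j * m + c')))"
    for i j c c' q
  have "hform (n * m) (kron A B) x = (\<Sum>i<n. \<Sum>c<m. \<Sum>j<n. \<Sum>c'<m. \<Sum>q\<in>Q. T i j c c' q)"
    unfolding hform_def sum_div_mod
  proof (intro sum.cong refl)
    fix i c j c' assume "i \<in> {..<n}" "c \<in> {..<m}" "j \<in> {..<n}" "c' \<in> {..<m}"
    then have "kron A B $$ (i * m + c, j * m + c') = A $$ (i,j) * (\<Sum>q\<in>Q. s q * \<phi> q c * cnj (\<phi> q c'))"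
      by (simp add: kron_index[OF A B] index_less_mult Bsum)
    then show "cnj (x (i * m + c)) * kron A B $$ (i * m + c, j * m + c') * x (j * m + c') = (\<Sum>q\<in>Q. T i j c c' q)"
      by (simp add: T_def sum_distrib_left sum_distrib_right mult_ac)
  qed
  also have "\<dots> = (\<Sum>i<n. \<Sum>j<n. \<Sum>c<m. \<Sum>c'<m. \<Sum>q\<in>Q. T i j c c' q)"
    by (intro sum.cong refl sum.swap)
  also have "\<dots> = (\<Sum>i<n. \<Sum>j<n. \<Sum>c<m. \<Sum>q\<in>Q. \<Sum>c'<m. T i j c c' q)"
    by (intro sum.cong refl sum.swap)
  also have "\<dots> = (\<Sum>i<n. \<Sum>j<n. \<Sum>q\<in>Q. \<Sum>c<m. \<Sum>c'<m. T i j c c' q)"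
    by (intro sum.cong refl sum.swap)
  also have "\<dots> = (\<Sum>i<n. \<Sum>q\<in>Q. \<Sum>j<n. \<Sum>c<m. \<Sum>c'<m. T i j c c' q)"
    by (intro sum.cong refl sum.swap)
  also have "\<dots> = (\<Sum>q\<in>Q. \<Sum>i<n. \<Sum>j<n. \<Sum>c<m. \<Sum>c'<m. T i j c c' q)"
    by (rule sum.swap)
  also have "\<dots> = (\<Sum>q\<in>Q. s q * hform n A (\<lambda>i. \<Sum>c<m. cnj (\<phi> q c) * x (i * m + c)))"
  proof (intro sum.cong refl)
    fix q
    have "(\<Sum>c<m. \<Sum>c'<m. T i j c c' q) = s q * (cnj (\<Sum>c<m. cnj (\<phi> q c) * x (i * m + c)) * A $$ (i,j) * (\<Sum>c<m. cnj (\<phi> q c) * x (j * m + c)))" for i j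
      unfolding T_def cnj_sum sum_distrib_left sum_distrib_right by (subst sum.swap) simp
    then show "(\<Sum>i<n. \<Sum>j<n. \<Sum>c<m. \<Sum>c'<m. T i j c c' q) = s q * hform n A (\<lambda>i. \<Sum>c<m. cnj (\<phi> q c) * x (i * m + c))"
      by (simp only: hform_def sum_distrib_left)
  qed
  finally show ?thesis .
qed

text \<open>In eigencoordinates the gap of each summand is the square |x - d y|^2 divided by d;
  Parseval identifies the pairing of coordinates with that of the vectors.\<close>

lemma hform_fenchel:
  assumes U: "unitary n U" and r: "\<And>k. k < n \<Longrightarrow> 0 < r k"
  shows "2 * Re (\<Sum>i<n. cnj (z i) * u i)
    \<le> Re (hform n (spec_mat n U (\<lambda>k. inverse (r k))) z) + Re (hform n (spec_mat n U r) u)"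
proof -
  have "2 * Re (cnj x * y) \<le> inverse d * (cmod x)\<^sup>2 + d * (cmod y)\<^sup>2" if d: "0 < d" for d and x y :: complex
  proof -
    have "inverse d * (cmod x)\<^sup>2 + d * (cmod y)\<^sup>2 - 2 * Re (cnj x * y) = inverse d * (cmod (x - of_real d * y))\<^sup>2"
      using d unfolding cmod_power2 by (simp add: field_simps power2_eq_square)
    moreover have "0 \<le> inverse d * (cmod (x - of_real d * y))\<^sup>2" using d by simp
    ultimately show ?thesis by linarith
  qed
  then have "(\<Sum>k<n. 2 * Re (cnj (coef n U z k) * coef n U u k))
     \<le> (\<Sum>k<n. inverse (r k) * (cmod (coef n U z k))\<^sup>2 + r k * (cmod (coef n U u k))\<^sup>2)"
    using r by (intro sum_mono) auto
  then show ?thesis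
    unfolding parseval[OF U, of z u, symmetric] hform_spec_mat[OF unitary_carrier[OF U]] Re_complex_of_real
    by (simp only: Re_sum sum_distrib_left sum.distrib)
qed

section \<open>Partial traces as sums of compressions\<close>

lemma ptrace2_carrier [simp]: "ptrace2 d1 d2 R \<in> carrier_mat d1 d1"
  by (simp add: ptrace2_def)

lemma ptrace1_carrier [simp]: "ptrace1 d1 d2 R \<in> carrier_mat d2 d2"
  by (simp add: ptrace1_def)

text \<open>The function under the sum is \<open>y\<close> tensored with the basis vector e_b, so
  the partial trace appears as a sum of compressions of \<open>R\<close>.\<close>

lemma hform_ptrace2:
  "hform d1 (ptrace2 d1 d2 R) y
    = (\<Sum>b<d2. hform (d1 * d2) R (\<lambda>i. if i mod d2 = b then y (i div d2) else 0))"
proof -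
  have "hform (d1 * d2) R (\<lambda>i. if i mod d2 = b then y (i div d2) else 0)
      = (\<Sum>a<d1. \<Sum>a'<d1. cnj (y a) * R $$ (a * d2 + b, a' * d2 + b) * y a')" if "b < d2" for b
  proof -
    have "hform (d1 * d2) R (\<lambda>i. if i mod d2 = b then y (i div d2) else 0)
      = (\<Sum>a<d1. \<Sum>b'<d2. \<Sum>a'<d1. \<Sum>b''<d2. if b' = b then (if b'' = b then cnj (y a) * R $$ (a * d2 + b, a' * d2 + b) * y a' else 0) else 0)"
      unfolding hform_def sum_div_mod by (intro sum.cong refl) auto
    also have "\<dots> = (\<Sum>a<d1. \<Sum>a'<d1. \<Sum>b'<d2. \<Sum>b''<d2. if b' = b then (if b'' = b then cnj (y a) * R $$ (a * d2 + b, a' * d2 + b) * y a' else 0) else 0)"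
      by (intro sum.cong refl sum.swap)
    also have "\<dots> = (\<Sum>a<d1. \<Sum>a'<d1. cnj (y a) * R $$ (a * d2 + b, a' * d2 + b) * y a')"
    proof (intro sum.cong refl)
      fix a a'
      let ?t = "cnj (y a) * R $$ (a * d2 + b, a' * d2 + b) * y a'"
      have "(\<Sum>b''<d2. if b' = b then (if b'' = b then ?t else 0) else 0) = (if b' = b then ?t else 0)" for b'
        using that by (cases "b' = b") auto
      then show "(\<Sum>b'<d2. \<Sum>b''<d2. if b' = b then (if b'' = b then ?t else 0) else 0) = ?t"
        using that by simp
    qed
    finally show ?thesis .
  qed
  then have "(\<Sum>b<d2. hform (d1 * d2) R (\<lambda>i. if i mod d2 = b then y (i div d2) else 0))
    = (\<Sum>b<d2. \<Sum>a<d1. \<Sum>a'<d1. cnj (y a) * R $$ (a * d2 + b, a' * d2 + b) * y a')"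
    by simp
  also have "\<dots> = (\<Sum>a<d1. \<Sum>b<d2. \<Sum>a'<d1. cnj (y a) * R $$ (a * d2 + b, a' * d2 + b) * y a')"
    by (rule sum.swap)
  also have "\<dots> = (\<Sum>a<d1. \<Sum>a'<d1. \<Sum>b<d2. cnj (y a) * R $$ (a * d2 + b, a' * d2 + b) * y a')"
    by (intro sum.cong refl sum.swap)
  also have "\<dots> = hform d1 (ptrace2 d1 d2 R) y"
    unfolding hform_def by (intro sum.cong refl) (simp add: ptrace2_def sum_distrib_left sum_distrib_right)
  finally show ?thesis by simp
qed

lemma hform_ptrace1:
  "hform d2 (ptrace1 d1 d2 R) y
    = (\<Sum>b<d1. hform (d1 * d2) R (\<lambda>i. if i div d2 = b then y (i mod d2) else 0))"
proof -
  have "hform (d1 * d2) R (\<lambda>i. if i div d2 = b then y (i mod d2) else 0)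
      = (\<Sum>c<d2. \<Sum>c'<d2. cnj (y c) * R $$ (b * d2 + c, b * d2 + c') * y c')" if "b < d1" for b
  proof -
    have "hform (d1 * d2) R (\<lambda>i. if i div d2 = b then y (i mod d2) else 0)
      = (\<Sum>a<d1. if a = b then (\<Sum>c<d2. \<Sum>a'<d1. if a' = b then (\<Sum>c'<d2. cnj (y c) * R $$ (b * d2 + c, b * d2 + c') * y c') else 0) else 0)"
      unfolding hform_def sum_div_mod
    proof (rule sum.cong[OF refl])
      fix a
      have "(\<Sum>a'<d1. \<Sum>c'<d2. cnj (y c) * R $$ (b * d2 + c, a' * d2 + c') * (if (a' * d2 + c') div d2 = b then y ((a' * d2 + c') mod d2) else 0))
        = (\<Sum>a'<d1. if a' = b then (\<Sum>c'<d2. cnj (y c) * R $$ (b * d2 + c, b * d2 + c') * y c') else 0)" for c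
      proof (rule sum.cong[OF refl])
        fix a'
        show "(\<Sum>c'<d2. cnj (y c) * R $$ (b * d2 + c, a' * d2 + c') * (if (a' * d2 + c') div d2 = b then y ((a' * d2 + c') mod d2) else 0))
          = (if a' = b then (\<Sum>c'<d2. cnj (y c) * R $$ (b * d2 + c, b * d2 + c') * y c') else 0)"
          by (cases "a' = b") simp_all
      qed
      then show "(\<Sum>c<d2. \<Sum>a'<d1. \<Sum>c'<d2. cnj (if (a * d2 + c) div d2 = b then y ((a * d2 + c) mod d2) else 0)
            * R $$ (a * d2 + c, a' * d2 + c') * (if (a' * d2 + c') div d2 = b then y ((a' * d2 + c') mod d2) else 0))
        = (if a = b then (\<Sum>c<d2. \<Sum>a'<d1. if a' = b then (\<Sum>c'<d2. cnj (y c) * R $$ (b * d2 + c, b * d2 + c') * y c') else 0) else 0)"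
        by (cases "a = b") simp_all
    qed
    then show ?thesis using that by simp
  qed
  then have "(\<Sum>b<d1. hform (d1 * d2) R (\<lambda>i. if i div d2 = b then y (i mod d2) else 0))
    = (\<Sum>b<d1. \<Sum>c<d2. \<Sum>c'<d2. cnj (y c) * R $$ (b * d2 + c, b * d2 + c') * y c')"
    by simp
  also have "\<dots> = (\<Sum>c<d2. \<Sum>b<d1. \<Sum>c'<d2. cnj (y c) * R $$ (b * d2 + c, b * d2 + c') * y c')"
    by (rule sum.swap)
  also have "\<dots> = (\<Sum>c<d2. \<Sum>c'<d2. \<Sum>b<d1. cnj (y c) * R $$ (b * d2 + c, b * d2 + c') * y c')"
    by (intro sum.cong refl sum.swap)
  also have "\<dots> = hform d2 (ptrace1 d1 d2 R) y"
    unfolding hform_def by (intro sum.cong refl) (simp add: ptrace1_def sum_distrib_left sum_distrib_right)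
  finally show ?thesis by simp
qed

text \<open>All compressions are nonnegative and the one with b = 0 is strictly positive. For
  \<open>d2 = 0\<close> there is none, and the partial trace would be the zero matrix.\<close>

lemma pos_def_ptrace2:
  assumes R: "R \<in> carrier_mat (d1 * d2) (d1 * d2)" and pd: "pos_def R" and d2: "0 < d2"
  shows "pos_def (ptrace2 d1 d2 R)"
proof (rule pos_defI)
  have h: "\<And>i j. i < d1 * d2 \<Longrightarrow> j < d1 * d2 \<Longrightarrow> cnj (R $$ (j,i)) = R $$ (i,j)"
    using pd hermitian_iff[OF R] by (auto simp: pos_def_def)
  show "hermitian (ptrace2 d1 d2 R)"
    by (subst hermitian_iff[OF ptrace2_carrier]) (auto simp: ptrace2_def h index_less_mult)
  fix v :: "nat \<Rightarrow> complex" and i assume i: "i < d1" "v i \<noteq> 0"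
  show "0 < Re (hform d1 (ptrace2 d1 d2 R) v)"
    unfolding hform_ptrace2 Re_sum
  proof (rule sum_pos2[of _ 0])
    show "0 < Re (hform (d1 * d2) R (\<lambda>i. if i mod d2 = 0 then v (i div d2) else 0))"
      by (rule pos_def_hform[OF R pd, of "i * d2 + 0"]) (use i d2 index_less_mult[of i d1 0 d2] in auto)
  qed (use d2 pos_def_hform_nonneg[OF R pd] in auto)
qed simp

lemma pos_def_ptrace1:
  assumes R: "R \<in> carrier_mat (d1 * d2) (d1 * d2)" and pd: "pos_def R" and d1: "0 < d1"
  shows "pos_def (ptrace1 d1 d2 R)"
proof (rule pos_defI)
  have h: "\<And>i j. i < d1 * d2 \<Longrightarrow> j < d1 * d2 \<Longrightarrow> cnj (R $$ (j,i)) = R $$ (i,j)"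
    using pd hermitian_iff[OF R] by (auto simp: pos_def_def)
  show "hermitian (ptrace1 d1 d2 R)"
    by (subst hermitian_iff[OF ptrace1_carrier]) (auto simp: ptrace1_def h index_less_mult)
  fix v :: "nat \<Rightarrow> complex" and i assume i: "i < d2" "v i \<noteq> 0"
  show "0 < Re (hform d2 (ptrace1 d1 d2 R) v)"
    unfolding hform_ptrace1 Re_sum
  proof (rule sum_pos2[of _ 0])
    show "0 < Re (hform (d1 * d2) R (\<lambda>i. if i div d2 = 0 then v (i mod d2) else 0))"
      by (rule pos_def_hform[OF R pd, of i]) (use i d1 index_less_mult[of 0 d1 i d2] in auto)
  qed (use d1 pos_def_hform_nonneg[OF R pd] in auto)
qed simp

section \<open>The inequality at exponent one\<close>

text \<open>Fenchel's inequality is applied to \<open>z b\<close> and \<open>y \<otimes> e_b\<close>, where \<open>y\<close> is the inverse marginal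
  applied to \<open>w\<close>; summing over \<open>b\<close> turns the second form into that of the marginal at \<open>y\<close>.\<close>
lemma inverse_marginal_le:
  assumes U: "unitary (d1 * d2) U" and W: "unitary d1 W"
    and r: "\<And>k. k < d1 * d2 \<Longrightarrow> 0 < r k" and a: "\<And>k. k < d1 \<Longrightarrow> 0 < a k"
    and marg: "ptrace2 d1 d2 (spec_mat (d1 * d2) U r) = spec_mat d1 W a"
  shows "Re (hform d1 (spec_mat d1 W (\<lambda>k. inverse (a k))) (\<lambda>i. \<Sum>b<d2. z b (i * d2 + b)))
    \<le> (\<Sum>b<d2. Re (hform (d1 * d2) (spec_mat (d1 * d2) U (\<lambda>k. inverse (r k))) (z b)))"
proof -
  \<comment> \<open>The map y -> (y tensor e_b)_b compresses copies of the big matrix to its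
    marginal; \<open>w\<close> is the adjoint of this map applied to the family
    \<open>z\<close>.\<close>
  define w where "w i = (\<Sum>b<d2. z b (i * d2 + b))" for i
  define y where "y i = (\<Sum>l<d1. W $$ (i,l) * (of_real (inverse (a l)) * coef d1 W w l))" for i
  define u where "u b i = (if i mod d2 = b then y (i div d2) else 0)" for b i
  have cy: "coef d1 W y k = of_real (inverse (a k)) * coef d1 W w k" if "k < d1" for k
    unfolding y_def by (rule coef_synthesis[OF W that])
  define E where "E = Re (hform d1 (spec_mat d1 W (\<lambda>k. inverse (a k))) w)"
  have E: "E = (\<Sum>k<d1. inverse (a k) * (cmod (coef d1 W w k))\<^sup>2)"
    unfolding E_def hform_spec_mat[OF unitary_carrier[OF W]] Re_complex_of_real ..
  have wy: "Re (\<Sum>i<d1. cnj (w i) * y i) = E"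
  proof -
    have "(\<Sum>i<d1. cnj (w i) * y i) = (\<Sum>k<d1. of_real (inverse (a k) * (cmod (coef d1 W w k))\<^sup>2))"
      unfolding parseval[OF W, of w y, symmetric]
      by (intro sum.cong refl) (simp add: cy complex_norm_square mult_ac del: of_real_power)
    then show ?thesis by (simp only: E Re_sum Re_complex_of_real)
  qed
  have yy: "Re (hform d1 (spec_mat d1 W a) y) = E"
    unfolding hform_spec_mat[OF unitary_carrier[OF W]] Re_complex_of_real E
  proof (rule sum.cong[OF refl])
    fix k assume "k \<in> {..<d1}"
    then have k: "k < d1" by simp
    have "a k * (inverse (a k))\<^sup>2 = inverse (a k)" using a[OF k] by (simp add: power2_eq_square)
    then show "a k * (cmod (coef d1 W y k))\<^sup>2 = inverse (a k) * (cmod (coef d1 W w k))\<^sup>2"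
      by (simp only: cy[OF k] norm_mult norm_of_real power_mult_distrib power2_abs mult.assoc[symmetric])
  qed
  have zu: "(\<Sum>b<d2. \<Sum>i<d1*d2. cnj (z b i) * u b i) = (\<Sum>i<d1. cnj (w i) * y i)"
  proof -
    have "(\<Sum>i<d1*d2. cnj (z b i) * u b i) = (\<Sum>i<d1. cnj (z b (i * d2 + b)) * y i)" if "b < d2" for b
      unfolding sum_div_mod
    proof (intro sum.cong refl)
      fix i
      have "(\<Sum>b'<d2. cnj (z b (i * d2 + b')) * u b (i * d2 + b'))
        = (\<Sum>b'<d2. if b' = b then cnj (z b (i * d2 + b)) * y i else 0)"
        by (intro sum.cong refl) (auto simp: u_def)
      then show "(\<Sum>b'<d2. cnj (z b (i * d2 + b')) * u b (i * d2 + b')) = cnj (z b (i * d2 + b)) * y i"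
        using that by simp
    qed
    then have "(\<Sum>b<d2. \<Sum>i<d1*d2. cnj (z b i) * u b i) = (\<Sum>b<d2. \<Sum>i<d1. cnj (z b (i * d2 + b)) * y i)"
      by simp
    also have "\<dots> = (\<Sum>i<d1. cnj (w i) * y i)"
      unfolding w_def cnj_sum sum_distrib_right by (rule sum.swap)
    finally show ?thesis .
  qed
  \<comment> \<open>With this \<open>y\<close> the pairing and the form of the marginal both equal
    \<open>E\<close>. Fenchel's inequality then bounds 2 E by the desired sum plus E, and one E
    cancels.\<close>
  have "2 * E = (\<Sum>b<d2. 2 * Re (\<Sum>i<d1*d2. cnj (z b i) * u b i))"
    unfolding sum_distrib_left[symmetric] Re_sum[symmetric] zu wy by simp
  also have "\<dots> \<le> (\<Sum>b<d2. Re (hform (d1 * d2) (spec_mat (d1 * d2) U (\<lambda>k. inverse (r k))) (z b))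
       + Re (hform (d1 * d2) (spec_mat (d1 * d2) U r) (u b)))"
    by (intro sum_mono hform_fenchel[OF U r])
  also have "\<dots> = (\<Sum>b<d2. Re (hform (d1 * d2) (spec_mat (d1 * d2) U (\<lambda>k. inverse (r k))) (z b))) + E"
    unfolding sum.distrib yy[symmetric] marg[symmetric] hform_ptrace2 Re_sum u_def ..
  finally have "E \<le> (\<Sum>b<d2. Re (hform (d1 * d2) (spec_mat (d1 * d2) U (\<lambda>k. inverse (r k))) (z b)))"
    by simp
  then show ?thesis unfolding E_def w_def[abs_def] .
qed

text \<open>Expanding \<open>sigma\<close> in its eigenvectors contracts \<open>x\<close> on the
  left with a whole eigenvector over B and C. On the right, the marginal on C is a sum of rank-one
  terms over the slices of the eigenvectors at fixed b. For each eigenvector \<open>k\<close> the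
  two sides are those of \<open>inverse_marginal_le\<close>, weighted by \<open>s k\<close>.\<close>

lemma kron_marginals_le:
  assumes U: "unitary (dA * dB) U" and W: "unitary dA W" and V: "unitary (dB * dC) V"
    and r: "\<And>k. k < dA * dB \<Longrightarrow> 0 < r k" and a: "\<And>k. k < dA \<Longrightarrow> 0 < a k"
    and s: "\<And>k. k < dB * dC \<Longrightarrow> 0 < s k"
    and marg: "ptrace2 dA dB (spec_mat (dA * dB) U r) = spec_mat dA W a"
  shows "Re (hform (dA * (dB * dC)) (kron (spec_mat dA W (\<lambda>k. inverse (a k))) (spec_mat (dB * dC) V s)) x)
    \<le> Re (hform (dA * dB * dC) (kron (spec_mat (dA * dB) U (\<lambda>k. inverse (r k)))
           (ptrace1 dB dC (spec_mat (dB * dC) V s))) x)"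
proof -
  note UC = unitary_carrier[OF U] and WC = unitary_carrier[OF W] and VC = unitary_carrier[OF V]
  let ?Ai = "spec_mat dA W (\<lambda>k. inverse (a k))"
  let ?Ri = "spec_mat (dA * dB) U (\<lambda>k. inverse (r k))"
  let ?S = "spec_mat (dB * dC) V s"
  \<comment> \<open>\<open>x\<close> contracted over C with slice \<open>b\<close> of eigenvector
    \<open>k\<close>; the index \<open>i\<close> that remains runs over A tensor B.\<close>
  define z where "z k b i = (\<Sum>c<dC. cnj (V $$ (b * dC + c, k)) * x (i * dC + c))" for k b i
  have "hform (dA * (dB * dC)) (kron ?Ai ?S) x
    = (\<Sum>k<dB*dC. of_real (s k) * hform dA ?Ai (\<lambda>i. \<Sum>m<dB*dC. cnj (V $$ (m,k)) * x (i * (dB * dC) + m)))"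
    by (rule hform_kron_rank_one_sum) (auto simp: WC VC spec_mat_index[OF VC])
  \<comment> \<open>The two bracketings of the triple index agree: i (dB dC) + (b dC + c) = (i dB +
    b) dC + c.\<close>
  also have "\<dots> = (\<Sum>k<dB*dC. of_real (s k) * hform dA ?Ai (\<lambda>i. \<Sum>b<dB. z k b (i * dB + b)))"
    by (simp add: sum_div_mod[of _ dB dC] z_def algebra_simps)
  finally have L: "Re (hform (dA * (dB * dC)) (kron ?Ai ?S) x)
    = (\<Sum>k<dB*dC. s k * Re (hform dA ?Ai (\<lambda>i. \<Sum>b<dB. z k b (i * dB + b))))"
    by (simp add: Re_sum)
  have "hform (dA * dB * dC) (kron ?Ri (ptrace1 dB dC ?S)) x
    = (\<Sum>(k,b)\<in>{..<dB*dC}\<times>{..<dB}. of_real (s k) * hform (dA * dB) ?Ri (z k b))"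
    unfolding z_def case_prod_beta
  proof (rule hform_kron_rank_one_sum)
    fix c c' assume c: "c < dC" "c' < dC"
    have "ptrace1 dB dC ?S $$ (c, c') = (\<Sum>b<dB. \<Sum>k<dB*dC. of_real (s k) * V $$ (b * dC + c, k) * cnj (V $$ (b * dC + c', k)))"
      using c by (simp add: ptrace1_def spec_mat_index[OF VC] index_less_mult)
    also have "\<dots> = (\<Sum>k<dB*dC. \<Sum>b<dB. of_real (s k) * V $$ (b * dC + c, k) * cnj (V $$ (b * dC + c', k)))"
      by (rule sum.swap)
    finally show "ptrace1 dB dC ?S $$ (c, c') = (\<Sum>q\<in>{..<dB*dC}\<times>{..<dB}. of_real (s (fst q)) * V $$ (snd q * dC + c, fst q) * cnj (V $$ (snd q * dC + c', fst q)))"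
      by (simp add: sum.cartesian_product case_prod_beta)
  qed (use UC in auto)
  then have "Re (hform (dA * dB * dC) (kron ?Ri (ptrace1 dB dC ?S)) x)
    = (\<Sum>k<dB*dC. s k * (\<Sum>b<dB. Re (hform (dA * dB) ?Ri (z k b))))"
    by (simp add: sum.cartesian_product[symmetric] sum_distrib_left)
  moreover have "(\<Sum>k<dB*dC. s k * Re (hform dA ?Ai (\<lambda>i. \<Sum>b<dB. z k b (i * dB + b))))
     \<le> (\<Sum>k<dB*dC. s k * (\<Sum>b<dB. Re (hform (dA * dB) ?Ri (z k b))))"
    by (intro sum_mono mult_left_mono inverse_marginal_le[OF U W r a marg]) (use s less_imp_le in auto)
  ultimately show ?thesis by (simp add: L)
qed

section \<open>From exponent one to all exponents in [0,1]\<close>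

theorem theorem2:
  fixes dA dB dC :: nat and rho sigma :: "complex mat" and \<alpha> :: real
  assumes "rho \<in> carrier_mat (dA * dB) (dA * dB)"
    and "sigma \<in> carrier_mat (dB * dC) (dB * dC)"
    and "density rho" and "pos_def rho"
    and "density sigma" and "pos_def sigma"
    and "0 \<le> \<alpha>" and "\<alpha> \<le> 1"
  shows "loewner_le
           (kron (mpow (ptrace2 dA dB rho) (- \<alpha>)) (mpow sigma \<alpha>))
           (kron (mpow rho (- \<alpha>)) (mpow (ptrace1 dB dC sigma) \<alpha>))"
proof -
  \<comment> \<open>An empty matrix has trace 0, not 1. The resulting \<open>0 < dB\<close> is what
    makes both marginals positive definite, since each traces out B.\<close>
  have "dim_row rho \<noteq> 0"
    using \<open>density rho\<close> by (intro notI) (simp add: density_def mtrace_def)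
  then have dB: "0 < dB" using assms(1) by (auto intro!: gr0I)
  obtain U r where U: "unitary (dA * dB) U" and r: "\<And>i. i < dA * dB \<Longrightarrow> 0 < r i"
    and rho: "rho = spec_mat (dA * dB) U r" "\<And>t. mpow rho t = spec_mat (dA * dB) U (\<lambda>i. r i powr t)"
    by (rule mpow_spectral[OF assms(1,4)]) blast
  obtain W a where W: "unitary dA W" and a: "\<And>i. i < dA \<Longrightarrow> 0 < a i"
    and rhoA: "ptrace2 dA dB rho = spec_mat dA W a" "\<And>t. mpow (ptrace2 dA dB rho) t = spec_mat dA W (\<lambda>i. a i powr t)"
    by (rule mpow_spectral[OF ptrace2_carrier pos_def_ptrace2[OF assms(1,4) dB]]) blast
  obtain V s where V: "unitary (dB * dC) V" and s: "\<And>i. i < dB * dC \<Longrightarrow> 0 < s i"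
    and sigma: "sigma = spec_mat (dB * dC) V s" "\<And>t. mpow sigma t = spec_mat (dB * dC) V (\<lambda>i. s i powr t)"
    by (rule mpow_spectral[OF assms(2,6)]) blast
  obtain Z c where Z: "unitary dC Z" and c: "\<And>i. i < dC \<Longrightarrow> 0 < c i"
    and sigmaC: "ptrace1 dB dC sigma = spec_mat dC Z c" "\<And>t. mpow (ptrace1 dB dC sigma) t = spec_mat dC Z (\<lambda>i. c i powr t)"
    by (rule mpow_spectral[OF ptrace1_carrier pos_def_ptrace1[OF assms(2,6) dB]]) blast
  note UC = unitary_carrier[OF U] and WC = unitary_carrier[OF W]
    and VC = unitary_carrier[OF V] and ZC = unitary_carrier[OF Z]
  let ?N = "dA * dB * dC"
  \<comment> \<open>The eigenvalues of the two sides at exponent one, in the product eigenbases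
    \<open>kron W V\<close> and \<open>kron U Z\<close>.\<close>
  define f where "f k = inverse (a (k div (dB * dC))) * s (k mod (dB * dC))" for k
  define g where "g k = inverse (r (k div dC)) * c (k mod dC)" for k
  have N: "dA * (dB * dC) = ?N" by simp
  have KX: "unitary ?N (kron W V)" using unitary_kron[OF W V] by (simp add: N)
  have KY: "unitary ?N (kron U Z)" using unitary_kron[OF U Z] .
  have fpos: "0 < f k" if "k < ?N" for k
    using that a s div_mod_less[of k dA "dB * dC"] by (simp add: f_def N)
  have gpos: "0 < g k" if "k < ?N" for k
    using that r c div_mod_less[of k "dA * dB" dC] by (simp add: g_def)
  have le: "Re (hform ?N (spec_mat ?N (kron W V) f) v) \<le> Re (hform ?N (spec_mat ?N (kron U Z) g) v)" for v
  proof -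
    have "Re (hform (dA * (dB * dC)) (kron (spec_mat dA W (\<lambda>k. inverse (a k))) (spec_mat (dB * dC) V s)) v)
      \<le> Re (hform ?N (kron (spec_mat (dA * dB) U (\<lambda>k. inverse (r k))) (ptrace1 dB dC (spec_mat (dB * dC) V s))) v)"
      by (rule kron_marginals_le[OF U W V]) (simp_all add: r a s rhoA(1) flip: rho(1))
    \<comment> \<open>Folding the spectral form back into \<open>sigma\<close> exposes the marginal,
      whose own diagonalisation can then replace it; afterwards \<open>sigma\<close> is expanded
      again.\<close>
    then show ?thesis
      unfolding sigma(1)[symmetric] sigmaC(1)
      unfolding sigma(1) kron_spec_mat[OF WC VC] kron_spec_mat[OF UC ZC] N f_def g_def .
  qed
  \<comment> \<open>For positive reals p^(-\<alpha>) q^\<alpha> = (q / p)^\<alpha>: here the two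
    exponents merge into one.\<close>
  have powr_split: "spec_mat n K (\<lambda>k. p k powr (- \<alpha>) * q k powr \<alpha>) = spec_mat n K (\<lambda>k. (inverse (p k) * q k) powr \<alpha>)"
    if "K \<in> carrier_mat n n" "\<And>k. k < n \<Longrightarrow> 0 < p k" "\<And>k. k < n \<Longrightarrow> 0 < q k" for n K and p q :: "nat \<Rightarrow> real"
    using that spec_mat_carrier[OF that(1)]
    by (intro eq_matI) (auto simp: spec_mat_index powr_mult powr_minus inverse_powr less_imp_le intro!: sum.cong)
  have X: "kron (mpow (ptrace2 dA dB rho) (- \<alpha>)) (mpow sigma \<alpha>) = spec_mat ?N (kron W V) (\<lambda>k. f k powr \<alpha>)"
    unfolding rhoA(2) sigma(2) kron_spec_mat[OF WC VC] N f_def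
    using unitary_carrier[OF KX] a s div_mod_less[of _ dA "dB * dC"]
    by (intro powr_split) (auto simp: N)
  have Y: "kron (mpow rho (- \<alpha>)) (mpow (ptrace1 dB dC sigma) \<alpha>) = spec_mat ?N (kron U Z) (\<lambda>k. g k powr \<alpha>)"
    unfolding rho(2) sigmaC(2) kron_spec_mat[OF UC ZC] g_def
    using unitary_carrier[OF KY] r c div_mod_less[of _ "dA * dB" dC]
    by (intro powr_split) auto
  let ?X = "spec_mat ?N (kron W V) (\<lambda>k. f k powr \<alpha>)" and ?Y = "spec_mat ?N (kron U Z) (\<lambda>k. g k powr \<alpha>)"
  have XC: "?X \<in> carrier_mat ?N ?N" and YC: "?Y \<in> carrier_mat ?N ?N"
    using unitary_carrier[OF KX] unitary_carrier[OF KY] by simp_all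
  have "psd (?Y - ?X)"
  proof (rule psdI)
    show "?Y - ?X \<in> carrier_mat ?N ?N" using XC YC by (intro minus_carrier_mat)
    show "hermitian (?Y - ?X)"
      by (rule hermitian_minus[OF YC XC])
         (rule hermitian_spec_mat[OF unitary_carrier[OF KY]] hermitian_spec_mat[OF unitary_carrier[OF KX]])+
    show "0 \<le> Re (hform ?N (?Y - ?X) v)" for v
      using loewner_heinz[OF KX KY fpos gpos le assms(7,8), where v=v] by (simp add: hform_diff[OF YC XC])
  qed
  then show ?thesis
    unfolding loewner_le_def X Y using XC YC by auto
qed

end
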